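(* Suppose a network $H=(V,E)$, with link capacities $c_{uv}>0$ and arrival rates $\lambda_u\ge0$, has tree structure. Then under any work-conserving discipline the maximum stability region is achieved; that is, the network is stable if and only if $$\sum_{u\in S}\lambda_u<\sum_{(u,v)\in E:\ u\in S,\ v\notin S}c_{uv}\qquad\text{for every } S\subset V,\ S\ne V,\ \text{with } \sum_{u\in S}\lambda_u>0 .$$
   Context: Network model. $H=(V,E)$ is a finite directed graph. At each node $u\in V$ new packets are created (arrive exogenously) according to a Poisson process of rate $\lambda_u\ge0$; $u$ is the source of these packets. For each link $(u,v)\in E$ there is a Poisson process of rate $c_{uv}>0$ of communication epochs; at each such epoch node $u$ may instantly transmit a copy of one packet to node $v$ (keeping its own copy). All these Poisson processes are mutually independent. A packet leaves the network as soon as it is available at all nodes of $V$. A packet is useful on link $(u,v)$ at a given time if it is available at $u$ but not at $v$ (it need not have source $u$). A network has tree structure if its directed graph is obtained from an undirected tree on $V$ by replacing each undirected edge by the pair of directed links in both directions. A communication discipline is a (possibly randomized) rule specifying, as a function of the current state, which useful packet is transmitted at a communication epoch of a link. It is work-conserving if at any communication epoch of a link a useful packet is transmitted, unless no packet useful on that link is available. State and stability. The packets present are labelled $1,\dots,k$ in order of exogenous arrival (1 is the oldest), labels being decremented when an older packet leaves; the state $X(t)$ records, for each present packet, its source and the set of nodes at which it is available. $X(\cdot)$ is a continuous-time Markov chain on the countable set of states reachable from the empty state. The network is stable if $X(\cdot)$ is positive recurrent (equivalently, has a stationary distribution). The displayed cut condition is necessary for stability under any discipline, so a discipline under which it is also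 sufficient achieves the maximum stability region. *)

theory Defs
  imports "HOL-Probability.Probability"
begin

section \<open>Continuous-time Markov chains given by transition rates\<close>

text \<open>
  A chain on \<open>'a\<close> is given by its rates \<open>q x y\<close> for \<open>x \<noteq> y\<close>; diagonal values of \<open>q\<close> (events
  that do not change the state) are ignored throughout.  The chain is realised by its jump chain
  \<open>Y\<close> and independent standard exponential variables \<open>\<xi>\<close>, the holding time of
  the \<open>n\<close>-th visited state being \<open>\<xi> n / exit_rate q (Y n)\<close>, which is infinite in an
  absorbing state.
\<close>

definition exit_rate :: "('a \<Rightarrow> 'a \<Rightarrow> real) \<Rightarrow> 'a \<Rightarrow> real" where
  "exit_rate q x = (\<Sum>\<^sub>\<infinity>y\<in>-{x}. q x y)"

definition jump_pmf :: "('a \<Rightarrow> 'a \<Rightarrow> real) \<Rightarrow> 'a \<Rightarrow> 'a pmf" where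
  "jump_pmf q x =
     (if exit_rate q x = 0 then return_pmf x
      else embed_pmf (\<lambda>y. if y = x then 0 else q x y / exit_rate q x))"

definition jump_step :: "('a \<Rightarrow> 'a \<Rightarrow> real) \<Rightarrow> 'a \<Rightarrow> nat \<Rightarrow> (nat \<Rightarrow> 'a) \<Rightarrow> 'a measure" where
  "jump_step q x n Y = measure_pmf (case n of 0 \<Rightarrow> return_pmf x | Suc m \<Rightarrow> jump_pmf q (Y m))"

interpretation jump_chain: Ionescu_Tulcea "jump_step q x" "\<lambda>_. count_space UNIV" for q x
proof (rule Ionescu_Tulcea.intro)
  fix n
  show "jump_step q x n \<in> PiM {0..<n} (\<lambda>_. count_space UNIV) \<rightarrow>\<^sub>M subprob_algebra (count_space UNIV)"
  proof (cases n)
    case 0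
    then show ?thesis
      by (simp add: jump_step_def[abs_def] measure_pmf_in_subprob_space)
  next
    case (Suc m)
    have "(\<lambda>Y. measure_pmf (jump_pmf q (Y m)))
        \<in> PiM {0..<n} (\<lambda>_. count_space UNIV) \<rightarrow>\<^sub>M subprob_algebra (count_space UNIV)"
      by (rule measurable_compose[where N = "count_space UNIV"])
        (auto simp: Suc measure_pmf_in_subprob_space intro!: measurable_component_singleton)
    then show ?thesis
      by (simp add: jump_step_def[abs_def] Suc)
  qed
next
  fix n and Y :: "nat \<Rightarrow> 'a"
  show "prob_space (jump_step q x n Y)"
    by (simp add: jump_step_def measure_pmf.prob_space_axioms)
qed

definition path_measure :: "('a \<Rightarrow> 'a \<Rightarrow> real) \<Rightarrow> 'a \<Rightarrow> ((nat \<Rightarrow> 'a) \<times> (nat \<Rightarrow> real)) measure" where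
  "path_measure q x =
     jump_chain.PF.lim q x \<Otimes>\<^sub>M PiM UNIV (\<lambda>_. density lborel (exponential_density 1))"

fun jump_time ::
  "('a \<Rightarrow> 'a \<Rightarrow> real) \<Rightarrow> (nat \<Rightarrow> 'a) \<times> (nat \<Rightarrow> real) \<Rightarrow> nat \<Rightarrow> ennreal" where
  "jump_time q (Y, \<xi>) n = (\<Sum>k<n. ennreal (\<xi> k) / ennreal (exit_rate q (Y k)))"

text \<open>The state at time \<open>t\<close>; \<open>None\<close> is a cemetery state, entered only on explosion.\<close>

definition state_at ::
  "('a \<Rightarrow> 'a \<Rightarrow> real) \<Rightarrow> (nat \<Rightarrow> 'a) \<times> (nat \<Rightarrow> real) \<Rightarrow> ennreal \<Rightarrow> 'a option" where
  "state_at q \<omega> t =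
     (if \<exists>n. t < jump_time q \<omega> (Suc n) then Some (fst \<omega> (LEAST n. t < jump_time q \<omega> (Suc n)))
      else None)"

definition return_time ::
  "('a \<Rightarrow> 'a \<Rightarrow> real) \<Rightarrow> 'a \<Rightarrow> (nat \<Rightarrow> 'a) \<times> (nat \<Rightarrow> real) \<Rightarrow> ennreal" where
  "return_time q x \<omega> = Inf {t. jump_time q \<omega> 1 \<le> t \<and> state_at q \<omega> t = Some x}"

definition positive_recurrent_state :: "('a \<Rightarrow> 'a \<Rightarrow> real) \<Rightarrow> 'a \<Rightarrow> bool" where
  "positive_recurrent_state q x \<longleftrightarrow>
     exit_rate q x = 0 \<or> (\<integral>\<^sup>+\<omega>. return_time q x \<omega> \<partial>path_measure q x) < \<infinity>"

definition reachable :: "('a \<Rightarrow> 'a \<Rightarrow> real) \<Rightarrow> 'a \<Rightarrow> 'a \<Rightarrow> bool" where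
  "reachable q = (\<lambda>x y. x \<noteq> y \<and> q x y > 0)\<^sup>*\<^sup>*"

definition positive_recurrent_from :: "('a \<Rightarrow> 'a \<Rightarrow> real) \<Rightarrow> 'a \<Rightarrow> bool" where
  "positive_recurrent_from q x \<longleftrightarrow> (\<forall>y. reachable q x y \<longrightarrow> positive_recurrent_state q y)"


section \<open>The network\<close>

text \<open>
  A packet is the pair of its source and the set of nodes where it is available.  A state lists
  the packets present, oldest first, so that the packet labelled \<open>i\<close> has list index \<open>i - 1\<close>.
\<close>

type_synonym 'v packet = "'v \<times> 'v set"
type_synonym 'v state = "'v packet list"

definition useful :: "'v state \<Rightarrow> 'v \<times> 'v \<Rightarrow> nat \<Rightarrow> bool" where
  "useful x e i \<longleftrightarrow> i < length x \<and> fst e \<in> snd (x ! i) \<and> snd e \<notin> snd (x ! i)"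

text \<open>
  A discipline \<open>D\<close> gives, for each state and link, the distribution of the index of the packet
  transmitted at a communication epoch of that link; \<open>None\<close> means that nothing is transmitted.
\<close>

type_synonym 'v discipline = "'v state \<Rightarrow> 'v \<times> 'v \<Rightarrow> nat option pmf"

definition is_discipline :: "('v \<times> 'v) set \<Rightarrow> 'v discipline \<Rightarrow> bool" where
  "is_discipline E D \<longleftrightarrow> (\<forall>x. \<forall>e\<in>E. \<forall>i. Some i \<in> set_pmf (D x e) \<longrightarrow> useful x e i)"

definition work_conserving :: "('v \<times> 'v) set \<Rightarrow> 'v discipline \<Rightarrow> bool" where
  "work_conserving E D \<longleftrightarrow> (\<forall>x. \<forall>e\<in>E. (\<exists>i. useful x e i) \<longrightarrow> None \<notin> set_pmf (D x e))"

definition depart :: "'v set \<Rightarrow> 'v state \<Rightarrow> 'v state" where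
  "depart V x = filter (\<lambda>p. \<not> V \<subseteq> snd p) x"

definition arrive :: "'v set \<Rightarrow> 'v \<Rightarrow> 'v state \<Rightarrow> 'v state" where
  "arrive V u x = depart V (x @ [(u, {u})])"

fun transmit :: "'v set \<Rightarrow> 'v \<Rightarrow> 'v state \<Rightarrow> nat option \<Rightarrow> 'v state" where
  "transmit V v x None = x"
| "transmit V v x (Some i) = depart V (x[i := (fst (x ! i), insert v (snd (x ! i)))])"

text \<open>
  The rates induced by mutually independent Poisson processes: rate \<open>arr u\<close> for the arrivals at
  node \<open>u\<close>, and rate \<open>cap e\<close> for the communication epochs of link \<open>e\<close>, thinned by
  the discipline's random choice.
\<close>

definition network_rate ::
  "'v set \<Rightarrow> ('v \<times> 'v) set \<Rightarrow> ('v \<Rightarrow> real) \<Rightarrow> ('v \<times> 'v \<Rightarrow> real) \<Rightarrow> 'v discipline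
    \<Rightarrow> 'v state \<Rightarrow> 'v state \<Rightarrow> real" where
  "network_rate V E arr cap D x y =
     (\<Sum>u\<in>V. if arrive V u x = y then arr u else 0) +
     (\<Sum>e\<in>E. cap e * pmf (map_pmf (transmit V (snd e) x) (D x e)) y)"

definition network_stable ::
  "'v set \<Rightarrow> ('v \<times> 'v) set \<Rightarrow> ('v \<Rightarrow> real) \<Rightarrow> ('v \<times> 'v \<Rightarrow> real) \<Rightarrow> 'v discipline \<Rightarrow> bool" where
  "network_stable V E arr cap D \<longleftrightarrow> positive_recurrent_from (network_rate V E arr cap D) []"


section \<open>Tree structure\<close>

definition is_cycle :: "'v set set \<Rightarrow> 'v list \<Rightarrow> bool" where
  "is_cycle T p \<longleftrightarrow>
     3 \<le> length p \<and> distinct p \<and> (\<forall>i. Suc i < length p \<longrightarrow> {p ! i, p ! Suc i} \<in> T) \<and>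
     {last p, hd p} \<in> T"

definition undirected_tree :: "'v set \<Rightarrow> 'v set set \<Rightarrow> bool" where
  "undirected_tree V T \<longleftrightarrow>
     V \<noteq> {} \<and> (\<forall>e\<in>T. e \<subseteq> V \<and> card e = 2) \<and>
     (\<forall>u\<in>V. \<forall>v\<in>V. (u, v) \<in> {(a, b). {a, b} \<in> T}\<^sup>*) \<and>
     (\<nexists>p. is_cycle T p)"

definition tree_structure :: "'v set \<Rightarrow> ('v \<times> 'v) set \<Rightarrow> bool" where
  "tree_structure V E \<longleftrightarrow> (\<exists>T. undirected_tree V T \<and> E = {(u, v). {u, v} \<in> T})"

end

theory Submission
  imports Defs
begin

text \<open>
  On a tree, a packet with source on the \<open>u\<close>-side of a link \<open>(u, v)\<close> must cross that link to
  reach \<open>v\<close>.  Let \<open>W\<^bsub>uv\<^esub>\<close> count the packets with source on the \<open>u\<close>-side that are missing at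
  \<open>v\<close>.  It grows at rate \<open>\<lambda>(u-side)\<close> and, under any work-conserving discipline, shrinks at
  rate \<open>c\<^bsub>uv\<^esub>\<close> whenever the link has a useful packet; when it has none, every packet counted by
  \<open>W\<^bsub>uv\<^esub>\<close> is missing at \<open>u\<close>, hence is counted by some \<open>W\<^bsub>wu\<^esub>\<close> with \<open>w \<noteq> v\<close>.  Since these
  upstream relations are acyclic, a weighted sum of the squares \<open>W\<^bsub>uv\<^esub>\<^sup>2\<close> with weights growing
  geometrically upstream is a Lyapunov function as soon as \<open>\<lambda>(u-side) < c\<^bsub>uv\<^esub>\<close> for all links,
  which is the cut condition for \<open>S = u-side\<close>.

  Conversely, if the condition fails for \<open>S\<close>, the number \<open>f\<close> of packets confined to \<open>S\<close> has
  nonnegative drift everywhere and positive drift at the empty state.  Stopping at the return to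
  the empty state, where \<open>f = 0\<close>, its expectation after \<open>k\<close> jumps is at least some \<open>a > 0\<close> and at most
  \<open>k P(N > k)\<close>, where \<open>N\<close> is the number of jumps until the return; so \<open>E N = \<infinity>\<close> by divergence of
  the harmonic series.
\<close>

section \<open>Return times and the jump chain\<close>

text \<open>On an initial segment the embedding of cylinder sets is the identity. Integrals of
  functions of the first \<open>n\<close> states thus reduce to the iterated kernel
  \<open>C\<close>, where induction on the number of steps is possible.\<close>

lemma distr_lim_restrict:
  "distr (jump_chain.PF.lim q x) (PiM {0..<n} (\<lambda>_. count_space UNIV)) (\<lambda>Y. restrict Y {0..<n})
    = jump_chain.C q x 0 n (\<lambda>_. undefined)" (is "distr ?L ?M ?r = ?C")
proof (rule measure_eqI)
  have C: "sets ?C = sets ?M"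
    using jump_chain.sets_C[of "\<lambda>_. undefined" 0 q x n] by (simp add: space_PiM)
  then show "sets (distr ?L ?M ?r) = sets ?C"
    by simp
  fix A assume "A \<in> sets (distr ?L ?M ?r)"
  then have A: "A \<in> sets ?M"
    by simp
  have "emeasure (distr ?L ?M ?r) A = emeasure (jump_chain.CI q x {0..<n}) A"
    by (simp add: jump_chain.distr_lim)
  also have "\<dots> = emeasure ?C (jump_chain.PF.emb {0..<n} {0..<n} A)"
    using A by (intro jump_chain.emeasure_CI) auto
  also have "jump_chain.PF.emb {0..<n} {0..<n} A = A"
    using sets.sets_into_space[OF A] by (simp add: prod_emb_id space_PiM)
  finally show "emeasure (distr ?L ?M ?r) A = emeasure ?C A" .
qed

text \<open>The transition operator of the jump chain killed on entering \<open>x\<close>. Only the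
  target is tested, so iterates started at \<open>x\<close> itself describe an excursion from
  \<open>x\<close>.\<close>

definition taboo_op :: "('a \<Rightarrow> 'a \<Rightarrow> real) \<Rightarrow> 'a \<Rightarrow> ('a \<Rightarrow> ennreal) \<Rightarrow> 'a \<Rightarrow> ennreal" where
  "taboo_op q x g z = (\<integral>\<^sup>+y. (if y = x then 0 else g y) \<partial>measure_pmf (jump_pmf q z))"

text \<open>Index 0 is left out because the chain starts at \<open>x\<close>.\<close>

definition avoids :: "'a \<Rightarrow> nat \<Rightarrow> (nat \<Rightarrow> 'a) \<Rightarrow> bool" where
  "avoids x k Y \<longleftrightarrow> (\<forall>j\<in>{1..k}. Y j \<noteq> x)"

lemma measurable_avoids:
  fixes g :: "'a \<Rightarrow> ennreal"
  assumes "{..k} \<subseteq> J"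
  shows "(\<lambda>Y. if avoids x k Y then g (Y k) else 0) \<in> borel_measurable (PiM J (\<lambda>_. count_space UNIV))"
proof -
  have "Measurable.pred (PiM J (\<lambda>_. count_space UNIV)) (avoids x k)"
    unfolding avoids_def[abs_def]
    using assms by (intro pred_intros_finite measurable_compose[OF measurable_component_singleton,
        of _ J "\<lambda>_. count_space UNIV"]) auto
  moreover have "(\<lambda>Y. Y k) \<in> PiM J (\<lambda>_. count_space UNIV) \<rightarrow>\<^sub>M count_space UNIV"
    using assms by (intro measurable_component_singleton) auto
  then have "(\<lambda>Y. g (Y k)) \<in> borel_measurable (PiM J (\<lambda>_. count_space UNIV))"
    by (rule measurable_compose) simp
  ultimately show ?thesis
    by measurable
qed

text \<open>The kernel \<open>C\<close> appends states at the end, so the last state is integrated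
  out first. This turns \<open>g\<close> into \<open>taboo_op q x g\<close>, whence the induction
  over arbitrary \<open>g\<close>.\<close>

lemma nn_integral_C_avoids:
  "(\<integral>\<^sup>+Y. (if avoids x k Y then g (Y k) else 0) \<partial>jump_chain.C q x 0 (Suc k) (\<lambda>_. undefined))
     = (taboo_op q x ^^ k) g x"
proof (induction k arbitrary: g)
  case 0
  have "(\<integral>\<^sup>+Y. (if avoids x 0 Y then g (Y 0) else 0) \<partial>jump_chain.C q x 0 (Suc 0) (\<lambda>_. undefined))
      = (\<integral>\<^sup>+Y. (if avoids x 0 Y then g (Y 0) else 0) \<partial>jump_chain.eP q x 0 (\<lambda>_. undefined))"
    using jump_chain.measurable_eP[of q x 0]
    by (simp, subst bind_return[where N="PiM {0..<Suc 0} (\<lambda>_. count_space UNIV)"])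
      (auto simp: space_PiM)
  also have "\<dots> = g x"
    using measurable_avoids[of 0 "{0..<Suc 0}" x g]
    by (subst jump_chain.nn_integral_eP) (auto simp: space_PiM avoids_def jump_step_def)
  finally show ?case
    by simp
next
  case (Suc k)
  have m: "(\<lambda>Y. if avoids x (Suc k) Y then g (Y (Suc k)) else 0)
      \<in> borel_measurable (PiM {0..<Suc (Suc k)} (\<lambda>_. count_space UNIV))"
    by (rule measurable_avoids) auto
  have "(\<integral>\<^sup>+Y. (if avoids x (Suc k) Y then g (Y (Suc k)) else 0)
        \<partial>jump_chain.C q x 0 (Suc (Suc k)) (\<lambda>_. undefined))
      = (\<integral>\<^sup>+Y. (\<integral>\<^sup>+Z. (if avoids x (Suc k) Z then g (Z (Suc k)) else 0)
          \<partial>jump_chain.eP q x (Suc k) Y) \<partial>jump_chain.C q x 0 (Suc k) (\<lambda>_. undefined))"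
    using jump_chain.measurable_eP[of q x "Suc k"]
      jump_chain.sets_C[of "\<lambda>_. undefined" 0 q x "Suc k"] m
    apply (subst jump_chain.C.simps(2))
    apply (subst nn_integral_bind[where B="PiM {0..<Suc (Suc k)} (\<lambda>_. count_space UNIV)"])
      apply (simp_all add: space_PiM cong: measurable_cong_sets)
    done
  also have "\<dots> = (\<integral>\<^sup>+Y. (if avoids x k Y then taboo_op q x g (Y k) else 0)
        \<partial>jump_chain.C q x 0 (Suc k) (\<lambda>_. undefined))"
  proof (intro nn_integral_cong)
    fix Y assume "Y \<in> space (jump_chain.C q x 0 (Suc k) (\<lambda>_. undefined))"
    then have Y: "Y \<in> space (PiM {0..<Suc k} (\<lambda>_. count_space UNIV))"
      using jump_chain.space_C[of "\<lambda>_. undefined" 0 q x "Suc k"] by (simp add: space_PiM)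
    have av: "avoids x (Suc k) (Y(Suc k := z)) \<longleftrightarrow> avoids x k Y \<and> z \<noteq> x" for z
      by (auto simp: avoids_def atLeastAtMostSuc_conv)
    show "(\<integral>\<^sup>+Z. (if avoids x (Suc k) Z then g (Z (Suc k)) else 0) \<partial>jump_chain.eP q x (Suc k) Y)
        = (if avoids x k Y then taboo_op q x g (Y k) else 0)"
      using m Y by (subst jump_chain.nn_integral_eP)
        (auto simp: av jump_step_def taboo_op_def intro!: nn_integral_cong)
  qed
  also have "\<dots> = (taboo_op q x ^^ k) (taboo_op q x g) x"
    by (rule Suc.IH)
  finally show ?case
    by (simp add: funpow_swap1)
qed

lemma nn_integral_lim_avoids:
  "(\<integral>\<^sup>+Y. (if avoids x k Y then g (Y k) else 0) \<partial>jump_chain.PF.lim q x) = (taboo_op q x ^^ k) g x"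
proof -
  let ?f = "\<lambda>Y. if avoids x k Y then g (Y k) else 0"
  have m: "?f \<in> borel_measurable (PiM {0..<Suc k} (\<lambda>_. count_space UNIV))"
    by (rule measurable_avoids) auto
  have "(\<integral>\<^sup>+Y. ?f Y \<partial>jump_chain.PF.lim q x)
     = (\<integral>\<^sup>+Y. ?f (restrict Y {0..<Suc k}) \<partial>jump_chain.PF.lim q x)"
    by (intro nn_integral_cong) (auto simp: avoids_def)
  also have "\<dots> = (\<integral>\<^sup>+Y. ?f Y \<partial>distr (jump_chain.PF.lim q x)
      (PiM {0..<Suc k} (\<lambda>_. count_space UNIV)) (\<lambda>Y. restrict Y {0..<Suc k}))"
    by (subst nn_integral_distr) (auto intro!: measurable_restrict_subset m cong: measurable_cong_sets)
  finally show ?thesis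
    by (simp add: distr_lim_restrict nn_integral_C_avoids del: jump_chain.C.simps)
qed

lemma prob_space_lim: "prob_space (jump_chain.PF.lim q x)"
  using nn_integral_lim_avoids[where k=0 and g="\<lambda>_. 1" and x=x and q=q] by (intro prob_spaceI) (simp add: avoids_def)

section \<open>Independent exponential holding times\<close>

abbreviation std_exp :: "real measure" where
  "std_exp \<equiv> density lborel (exponential_density 1)"

lemma prob_space_std_exp: "prob_space std_exp"
  by (rule prob_space_exponential_density) simp

lemma nn_integral_std_exp: "(\<integral>\<^sup>+t. ennreal t \<partial>std_exp) = 1"
proof -
  have "(\<integral>\<^sup>+t. ennreal t \<partial>std_exp) = (\<integral>\<^sup>+t. ennreal (exponential_density 1 t * t ^ 1) \<partial>lborel)"
    by (subst nn_integral_density) (auto simp: ennreal_mult' intro!: nn_integral_cong)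
  also have "\<dots> = 1"
    by (subst nn_integral_erlang_ith_moment) simp_all
  finally show ?thesis .
qed

lemma AE_std_exp_pos: "AE t in std_exp. 0 < t"
proof -
  have "AE t in lborel. (t::real) \<noteq> 0"
    by (rule AE_lborel_singleton)
  then show ?thesis
    by (subst AE_density) (auto simp: exponential_density_def)
qed

lemma nn_integral_PiM_std_exp:
  "(\<integral>\<^sup>+\<xi>. ennreal (\<xi> k) \<partial>PiM (UNIV :: nat set) (\<lambda>_. std_exp)) = 1"
proof -
  have "(\<integral>\<^sup>+\<xi>. ennreal (\<xi> k) \<partial>PiM (UNIV :: nat set) (\<lambda>_. std_exp))
     = (\<integral>\<^sup>+t. ennreal t \<partial>distr (PiM (UNIV :: nat set) (\<lambda>_. std_exp)) std_exp (\<lambda>\<xi>. \<xi> k))"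
    by (subst nn_integral_distr) auto
  also have "\<dots> = 1"
    by (subst distr_PiM_component) (auto simp: prob_space_std_exp nn_integral_std_exp)
  finally show ?thesis .
qed

lemma measurable_fst_path:
  "f \<in> borel_measurable (PiM UNIV (\<lambda>_. count_space UNIV)) \<Longrightarrow>
    (\<lambda>\<omega>. f (fst \<omega>) :: ennreal) \<in> borel_measurable (path_measure q x)"
  unfolding path_measure_def
  by (rule measurable_compose[OF measurable_fst]) (simp cong: measurable_cong_sets)

lemma measurable_snd_path [measurable]:
  "(\<lambda>\<omega>. snd \<omega> k) \<in> borel_measurable (path_measure q x)"
  unfolding path_measure_def
  by (rule measurable_compose[OF measurable_snd], rule measurable_compose[OF measurable_component_singleton])
    auto

lemma AE_path_measure_pos: "AE \<omega> in path_measure q x. \<forall>k. 0 < snd \<omega> k"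
proof -
  interpret L: prob_space "jump_chain.PF.lim q x"
    by (rule prob_space_lim)
  interpret X: prob_space "PiM (UNIV :: nat set) (\<lambda>_. std_exp)"
    by (intro prob_space_PiM prob_space_std_exp)
  interpret P: pair_prob_space "jump_chain.PF.lim q x" "PiM (UNIV :: nat set) (\<lambda>_. std_exp)" ..
  have "AE \<xi> in PiM (UNIV :: nat set) (\<lambda>_. std_exp). \<forall>k. 0 < \<xi> k"
    unfolding AE_all_countable
    by (intro allI AE_PiM_component) (auto simp: prob_space_std_exp AE_std_exp_pos)
  moreover have "{\<omega> \<in> space (path_measure q x). \<forall>k. 0 < snd \<omega> k} \<in> sets (path_measure q x)"
    by measurable
  ultimately show ?thesis
    unfolding path_measure_def by (intro P.AE_pair_measure) auto
qed

text \<open>The holding variables are independent of the jump chain and have mean 1, so Tonelli's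
  theorem replaces each of them by 1. With \<open>g\<close> the reciprocal exit rate, this computes
  the expected total holding time before the return to \<open>x\<close>.\<close>

lemma nn_integral_path_avoids:
  "(\<integral>\<^sup>+\<omega>. (\<Sum>k. (if avoids x k (fst \<omega>) then g (fst \<omega> k) else 0) * ennreal (snd \<omega> k)) \<partial>path_measure q x)
    = (\<Sum>k. (taboo_op q x ^^ k) g x)"
proof -
  interpret X: prob_space "PiM (UNIV :: nat set) (\<lambda>_. std_exp)"
    by (intro prob_space_PiM prob_space_std_exp)
  let ?f = "\<lambda>k Y. if avoids x k Y then g (Y k) else 0"
  note [measurable] = measurable_fst_path[OF measurable_avoids, of _ x g q x]
  have "(\<integral>\<^sup>+\<omega>. (\<Sum>k. ?f k (fst \<omega>) * ennreal (snd \<omega> k)) \<partial>path_measure q x)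
      = (\<Sum>k. \<integral>\<^sup>+\<omega>. ?f k (fst \<omega>) * ennreal (snd \<omega> k) \<partial>path_measure q x)"
    by (intro nn_integral_suminf) measurable
  moreover have "(\<integral>\<^sup>+\<omega>. ?f k (fst \<omega>) * ennreal (snd \<omega> k) \<partial>path_measure q x) = (taboo_op q x ^^ k) g x" for k
  proof -
    have "(\<integral>\<^sup>+\<omega>. ?f k (fst \<omega>) * ennreal (snd \<omega> k) \<partial>path_measure q x)
        = (\<integral>\<^sup>+Y. (\<integral>\<^sup>+\<xi>. ?f k Y * ennreal (\<xi> k) \<partial>PiM UNIV (\<lambda>_. std_exp)) \<partial>jump_chain.PF.lim q x)"
      unfolding path_measure_def
      by (subst X.nn_integral_fst[symmetric]) (auto simp: path_measure_def[symmetric] cong: if_cong)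
    also have "\<dots> = (\<integral>\<^sup>+Y. ?f k Y \<partial>jump_chain.PF.lim q x)"
      by (subst nn_integral_cmult) (auto simp: nn_integral_PiM_std_exp)
    finally show ?thesis
      by (simp add: nn_integral_lim_avoids)
  qed
  ultimately show ?thesis
    by simp
qed

section \<open>The return time as the sum of the holding times before the first return\<close>

lemma return_time_ge:
  "(\<Sum>k. if avoids x k Y then ennreal (\<xi> k) / ennreal (exit_rate q (Y k)) else 0)
    \<le> return_time q x (Y, \<xi>)" (is "(\<Sum>k. ?h k) \<le> _")
  unfolding return_time_def
proof (rule Inf_greatest, clarify)
  fix t assume t: "jump_time q (Y, \<xi>) 1 \<le> t" and st: "state_at q (Y, \<xi>) t = Some x"
  define n where "n = (LEAST n. t < jump_time q (Y, \<xi>) (Suc n))"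
  have ex: "\<exists>n. t < jump_time q (Y, \<xi>) (Suc n)" and Yn: "Y n = x"
    using st by (auto simp: state_at_def n_def split: if_splits)
  have lt: "t < jump_time q (Y, \<xi>) (Suc n)"
    unfolding n_def using ex by (rule LeastI_ex)
  then have "n \<noteq> 0"
    using t by (cases n) (auto simp flip: not_less)
  then obtain m where m: "n = Suc m"
    by (cases n) auto
  \<comment> \<open>Minimality of \<open>n\<close> puts \<open>t\<close> at or after the
    \<open>n\<close>-th jump.\<close>
  have "\<not> t < jump_time q (Y, \<xi>) (Suc m)"
    using not_less_Least[of m "\<lambda>n. t < jump_time q (Y, \<xi>) (Suc n)"] m unfolding n_def by auto
  \<comment> \<open>The visit to \<open>x\<close> at index \<open>n\<close> ends the avoidance, so
    the series stops there.\<close>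
  moreover have "(\<Sum>k. ?h k) = (\<Sum>k<n. ?h k)"
    using Yn m by (intro suminf_finite) (auto simp: avoids_def)
  moreover have "\<dots> \<le> jump_time q (Y, \<xi>) n"
    by (auto intro!: sum_mono)
  ultimately show "(\<Sum>k. ?h k) \<le> t"
    using m by (simp add: not_less del: jump_time.simps)
qed

text \<open>The holding time at the first return index \<open>n\<close> is positive, so the state is
  already \<open>x\<close> at the instant of the \<open>n\<close>-th jump. If that instant is
  infinite, the bound is trivial.\<close>

lemma return_time_le:
  assumes "\<not> avoids x k Y" and "\<And>k. 0 < \<xi> k"
  shows "return_time q x (Y, \<xi>)
    \<le> (\<Sum>k. if avoids x k Y then ennreal (\<xi> k) / ennreal (exit_rate q (Y k)) else 0)"
    (is "_ \<le> (\<Sum>k. ?h k)")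
proof -
  define n where "n = (LEAST n. 1 \<le> n \<and> Y n = x)"
  have ex: "\<exists>n. 1 \<le> n \<and> Y n = x"
    using assms by (auto simp: avoids_def)
  then have n: "1 \<le> n" "Y n = x"
    using LeastI_ex[OF ex] by (auto simp: n_def)
  have av: "avoids x j Y \<longleftrightarrow> j < n" for j
    using n not_less_Least[of _ "\<lambda>n. 1 \<le> n \<and> Y n = x"] unfolding avoids_def n_def[symmetric]
    by (auto simp: not_le[symmetric])
  have mono: "jump_time q (Y, \<xi>) i \<le> jump_time q (Y, \<xi>) j" if "i \<le> j" for i j
    using that by (auto intro!: sum_mono2)
  have sum: "(\<Sum>k. ?h k) = jump_time q (Y, \<xi>) n"
    by (subst suminf_finite[of "{..<n}"]) (auto simp: av)
  show ?thesis
  proof (cases "jump_time q (Y, \<xi>) n = \<top>")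
    case False
    let ?t = "jump_time q (Y, \<xi>) n"
    have "0 < ennreal (\<xi> n) / ennreal (exit_rate q (Y n))"
      using assms(2)[of n] by (simp add: ennreal_zero_less_divide)
    with False have lt: "?t < jump_time q (Y, \<xi>) (Suc n)"
      by (simp add: ennreal_add_left_cancel_less less_top)
    have "(LEAST i. ?t < jump_time q (Y, \<xi>) (Suc i)) = n"
    proof (rule Least_equality)
      show "?t < jump_time q (Y, \<xi>) (Suc n)"
        by (rule lt)
    next
      fix i assume i: "?t < jump_time q (Y, \<xi>) (Suc i)"
      show "n \<le> i"
      proof (rule ccontr)
        assume "\<not> n \<le> i"
        with mono[of "Suc i" n] i show False
          by simp
      qed
    qed
    with lt n have "state_at q (Y, \<xi>) ?t = Some x"
      unfolding state_at_def by (auto simp del: jump_time.simps)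
    then have "return_time q x (Y, \<xi>) \<le> ?t"
      unfolding return_time_def using mono[of 1 n] n by (intro Inf_lower) auto
    then show ?thesis
      by (simp only: sum)
  qed (simp only: sum top_greatest)
qed

section \<open>Foster criteria\<close>

lemma taboo_op_mono:
  "(\<And>y. y \<in> set_pmf (jump_pmf q z) \<Longrightarrow> g y \<le> h y) \<Longrightarrow> taboo_op q x g z \<le> taboo_op q x h z"
  unfolding taboo_op_def by (intro nn_integral_mono_AE) (auto simp: AE_measure_pmf_iff)

lemma taboo_op_le:
  "taboo_op q x g z \<le> (\<integral>\<^sup>+y. g y \<partial>measure_pmf (jump_pmf q z))"
  unfolding taboo_op_def by (intro nn_integral_mono) auto

lemma taboo_op_add:
  "taboo_op q x (\<lambda>y. g y + h y) z = taboo_op q x g z + taboo_op q x h z"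
  unfolding taboo_op_def by (subst nn_integral_add[symmetric]) (auto intro!: nn_integral_cong)

lemma taboo_op_cmult:
  "taboo_op q x (\<lambda>y. c * g y) z = c * taboo_op q x g z"
  unfolding taboo_op_def by (subst nn_integral_cmult[symmetric]) (auto intro!: nn_integral_cong)

lemma taboo_op_sum:
  "taboo_op q x (\<lambda>y. \<Sum>i\<in>I. g i y) z = (\<Sum>i\<in>I. taboo_op q x (g i) z)"
proof -
  have "(if y = x then 0 else \<Sum>i\<in>I. g i y) = (\<Sum>i\<in>I. if y = x then 0 else g i y)" for y
    by simp
  then show ?thesis
    unfolding taboo_op_def by (simp add: nn_integral_sum)
qed

lemma funpow_taboo_op_cmult:
  "(taboo_op q x ^^ k) (\<lambda>y. c * g y) = (\<lambda>z. c * (taboo_op q x ^^ k) g z)"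
  by (induction k) (auto simp: taboo_op_cmult intro!: ext)

text \<open>The value at \<open>z\<close> is the probability that the jump chain from \<open>z\<close> avoids \<open>x\<close> in the
  first \<open>k\<close> steps.\<close>

abbreviation survival :: "('a \<Rightarrow> 'a \<Rightarrow> real) \<Rightarrow> 'a \<Rightarrow> nat \<Rightarrow> 'a \<Rightarrow> ennreal" where
  "survival q x k \<equiv> (taboo_op q x ^^ k) (\<lambda>_. 1)"

lemma taboo_op_le_1: "(\<And>y. g y \<le> 1) \<Longrightarrow> taboo_op q x g z \<le> 1"
  using taboo_op_mono[of q z g "\<lambda>_. 1" x] taboo_op_le[of q x "\<lambda>_. 1" z]
  by (auto intro: order_trans)

lemma survival_le_1: "survival q x k z \<le> 1"
  by (induction k arbitrary: z) (auto intro!: taboo_op_le_1)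

lemma survival_Suc_le: "survival q x (Suc k) z \<le> survival q x k z"
proof (induction k arbitrary: z)
  case 0
  show ?case by (auto intro!: taboo_op_le_1)
next
  case (Suc k)
  show ?case
    unfolding funpow.simps(2)[of "Suc k"] funpow.simps(2)[of k] o_apply
    using Suc.IH by (intro taboo_op_mono) simp
qed

lemma survival_antimono: "j \<le> k \<Longrightarrow> survival q x k z \<le> survival q x j z"
  by (induction rule: dec_induct) (auto intro: order_trans[OF survival_Suc_le] simp del: funpow.simps)

text \<open>The integrand is at most 1 everywhere, and a single atom with a smaller value pulls the
  mean strictly below 1.\<close>

lemma taboo_op_less_1:
  assumes "\<And>y. g y \<le> 1" and "y \<in> set_pmf (jump_pmf q z)" and "y = x \<or> g y < 1"
  shows "taboo_op q x g z < 1"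
proof -
  let ?g = "\<lambda>y. if y = x then 0 else g y"
  have "\<not> (AE y in measure_pmf (jump_pmf q z). 1 \<le> ?g y)"
    using assms(2,3) by (auto simp: AE_measure_pmf_iff not_le intro!: bexI[of _ y])
  moreover have "integral\<^sup>N (measure_pmf (jump_pmf q z)) ?g \<noteq> \<infinity>"
    using taboo_op_le_1[of g q x z] assms(1) unfolding taboo_op_def by (auto simp: top_unique)
  ultimately have "integral\<^sup>N (measure_pmf (jump_pmf q z)) ?g < (\<integral>\<^sup>+y. 1 \<partial>measure_pmf (jump_pmf q z))"
    using assms(1) by (intro nn_integral_less) auto
  then show ?thesis
    by (simp add: taboo_op_def)
qed

text \<open>Follow a path to \<open>x\<close> backwards: its last step hits \<open>x\<close> with
  positive probability, and each earlier state inherits the loss of mass from its successor.\<close>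

lemma survival_less_1:
  assumes "(\<lambda>y z. z \<in> set_pmf (jump_pmf q y))\<^sup>+\<^sup>+ z x"
  shows "\<exists>k. survival q x k z < 1"
  using assms
proof (induction rule: converse_tranclp_induct)
  case (base z)
  then have "survival q x 1 z < 1"
    by (auto intro!: taboo_op_less_1)
  then show ?case ..
next
  case (step z y)
  then obtain k where "survival q x k y < 1"
    by blast
  with step have "survival q x (Suc k) z < 1"
    by (auto intro!: taboo_op_less_1 survival_le_1)
  then show ?case ..
qed

text \<open>The partial sums arise from 0 by iterating \<open>s\<close> to
  \<open>taboo_op q x s + 1\<close>, and \<open>h\<close> is a supersolution of this recursion, so
  it dominates every iterate.\<close>

lemma sum_survival_le:
  assumes closed: "\<And>z. z \<in> R \<Longrightarrow> set_pmf (jump_pmf q z) \<subseteq> R"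
    and h: "\<And>z. z \<in> R \<Longrightarrow> taboo_op q x h z + 1 \<le> h z"
    and "z \<in> R"
  shows "(\<Sum>k<n. survival q x k z) \<le> h z"
  using \<open>z \<in> R\<close>
proof (induction n arbitrary: z)
  case (Suc n)
  have "(\<Sum>k<Suc n. survival q x k z) = taboo_op q x (\<lambda>y. \<Sum>k<n. survival q x k y) z + 1"
    by (simp add: sum.lessThan_Suc_shift taboo_op_sum add.commute del: sum.lessThan_Suc)
  also have "\<dots> \<le> taboo_op q x h z + 1"
    using Suc closed by (intro add_mono taboo_op_mono) auto
  also have "\<dots> \<le> h z"
    using Suc h by auto
  finally show ?case .
qed simp

text \<open>The accumulated survival probabilities repair the drift on the finite exceptional set,
  because they decrease strictly there in expectation.\<close>

lemma foster:
  assumes closed: "\<And>z. z \<in> R \<Longrightarrow> set_pmf (jump_pmf q z) \<subseteq> R"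
    and F: "finite F" and fin: "\<And>z. L z < \<infinity>"
    and drift: "\<And>z. z \<in> R \<Longrightarrow> z \<notin> F \<Longrightarrow> (\<integral>\<^sup>+y. L y \<partial>measure_pmf (jump_pmf q z)) + 1 \<le> L z"
    and drift_F: "\<And>z. z \<in> F \<Longrightarrow> (\<integral>\<^sup>+y. L y \<partial>measure_pmf (jump_pmf q z)) < \<infinity>"
    and hit: "\<And>z. z \<in> F \<Longrightarrow> \<exists>k. survival q x k z < 1"
    and "z \<in> R"
  shows "(\<Sum>k. survival q x k z) < \<infinity>"
proof -
  obtain k where k: "\<And>z. z \<in> F \<Longrightarrow> survival q x (k z) z < 1"
    using hit by metis
  \<comment> \<open>One horizon serves all of \<open>F\<close>, since survival probabilities
    decrease in \<open>k\<close>. Inserting 0 keeps the maxima defined when \<open>F\<close> is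
    empty.\<close>
  define M where "M = Max (insert 0 (k ` F))"
  have M: "survival q x M z < 1" if "z \<in> F" for z
    using survival_antimono[where j="k z" and k=M and q=q and x=x and z=z] k[OF that] that F by (auto simp: M_def intro!: Max_ge)
  define \<rho> where "\<rho> = Max (insert 0 ((\<lambda>z. survival q x M z) ` F))"
  have \<rho>: "\<rho> < 1" "\<And>z. z \<in> F \<Longrightarrow> survival q x M z \<le> \<rho>"
    unfolding \<rho>_def using M F by (auto intro!: Max_ge)
  define b where "b = (\<Sum>z\<in>F. \<integral>\<^sup>+y. L y \<partial>measure_pmf (jump_pmf q z))"
  have b: "b < \<infinity>" "\<And>z. z \<in> F \<Longrightarrow> (\<integral>\<^sup>+y. L y \<partial>measure_pmf (jump_pmf q z)) \<le> b"
    unfolding b_def using drift_F F by (auto intro!: member_le_sum)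
  \<comment> \<open>\<open>K\<close> is chosen so that a decrease of \<open>1 - \<rho>\<close> in
    \<open>G\<close> on \<open>F\<close> pays for the mean of \<open>L\<close> after the jump and
    for the required decrement 1.\<close>
  define K where "K = (b + 1) / (1 - \<rho>)"
  have pos: "0 < 1 - \<rho>"
    using \<rho>(1) by (simp add: diff_gr0_ennreal)
  have K: "K < \<infinity>" "K * (1 - \<rho>) = b + 1"
    unfolding K_def using b(1) pos
    by (auto simp: ennreal_divide_times ennreal_divide_self ennreal_divide_eq_top_iff less_top[symmetric])
  define G where "G z = (\<Sum>k<M. survival q x k z)" for z
  define h where "h z = L z + K * G z" for z
  \<comment> \<open>A telescoping identity: one step shifts the summation range from
    \<open>0..M-1\<close> to \<open>1..M\<close>.\<close>
  have G: "taboo_op q x G z + 1 = G z + survival q x M z" for z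
  proof -
    have "taboo_op q x G z + 1 = (\<Sum>k<Suc M. survival q x k z)"
      by (simp add: G_def[abs_def] sum.lessThan_Suc_shift taboo_op_sum add.commute del: sum.lessThan_Suc)
    then show ?thesis
      by (simp add: G_def)
  qed
  have Gfin: "G z < \<infinity>" for z
    unfolding G_def by (simp add: le_less_trans[OF survival_le_1])
  have G_le: "taboo_op q x G z \<le> G z" for z
  proof -
    have "1 + taboo_op q x G z \<le> 1 + G z"
      using G[of z] survival_le_1[where q=q and x=x and z=z and k=M]
      by (simp add: add.commute add_left_mono)
    then show ?thesis
      by (simp add: ennreal_add_left_cancel_le)
  qed
  have G_F: "taboo_op q x G z + (1 - \<rho>) \<le> G z" if "z \<in> F" for z
  proof -
    \<comment> \<open>Adding \<open>\<rho>\<close> before cancelling it avoids the truncated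
      subtraction of \<open>ennreal\<close>.\<close>
    have "\<rho> + (taboo_op q x G z + (1 - \<rho>)) = taboo_op q x G z + 1"
      using \<rho>(1) by (simp add: add_diff_inverse_ennreal less_imp_le add.left_commute)
    also have "\<dots> \<le> \<rho> + G z"
      using G[of z] \<rho>(2)[OF that] by (simp add: add.commute add_left_mono)
    finally show ?thesis
      using \<rho>(1) by (auto simp: ennreal_add_left_cancel_le)
  qed
  have h: "taboo_op q x h z + 1 \<le> h z" if "z \<in> R" for z
  proof -
    have *: "taboo_op q x h z \<le> (\<integral>\<^sup>+y. L y \<partial>measure_pmf (jump_pmf q z)) + K * taboo_op q x G z"
      unfolding h_def[abs_def] taboo_op_add taboo_op_cmult by (intro add_right_mono taboo_op_le)
    show ?thesis
    proof (cases "z \<in> F")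
      case True
      \<comment> \<open>On \<open>F\<close> the term \<open>K * G z\<close> alone covers everything;
        \<open>L z\<close> is discarded.\<close>
      have "taboo_op q x h z + 1 \<le> (b + 1) + K * taboo_op q x G z"
        using * b(2)[OF True] by (simp add: add.commute add.left_commute add_left_mono order_trans[OF *])
      also have "\<dots> = K * (taboo_op q x G z + (1 - \<rho>))"
        by (simp add: K(2) distrib_left add.commute)
      also have "\<dots> \<le> K * G z"
        by (intro mult_left_mono G_F True) auto
      also have "\<dots> \<le> h z"
        by (simp add: h_def)
      finally show ?thesis .
    next
      case False
      have "taboo_op q x h z + 1 \<le> ((\<integral>\<^sup>+y. L y \<partial>measure_pmf (jump_pmf q z)) + 1) + K * taboo_op q x G z"
        using * by (simp add: add.commute add.left_commute add_left_mono)
      also have "\<dots> \<le> L z + K * G z"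
        using that False by (intro add_mono drift mult_left_mono G_le) auto
      finally show ?thesis
        by (simp add: h_def)
    qed
  qed
  have "(\<Sum>k. survival q x k z) \<le> h z"
    using sum_survival_le[where R=R and q=q and x=x and h=h and z=z] closed h \<open>z \<in> R\<close>
    by (auto simp: suminf_eq_SUP intro!: SUP_least)
  also have "\<dots> < \<infinity>"
    using fin[of z] Gfin[of z] K(1) by (simp add: h_def ennreal_mult_less_top)
  finally show ?thesis .
qed

section \<open>Drift criteria for chains with bounded rates\<close>

lemma one_divide_ennreal_antimono:
  assumes "a \<le> b"
  shows "1 / ennreal b \<le> 1 / ennreal a"
proof (cases "0 < a")
  case True
  have "ennreal (1 / b) \<le> ennreal (1 / a)"
    using True assms by (intro ennreal_leI) (simp add: field_simps)
  then show ?thesis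
    using True assms divide_ennreal[of 1 a] divide_ennreal[of 1 b] by simp
next
  case False
  then show ?thesis
    by (simp add: ennreal_neg)
qed

text \<open>The generator of the chain applied to \<open>f\<close>; a diagonal rate contributes
  zero.\<close>

definition drift :: "('a \<Rightarrow> 'a \<Rightarrow> real) \<Rightarrow> ('a \<Rightarrow> real) \<Rightarrow> 'a \<Rightarrow> real" where
  "drift q f x = (\<Sum>y | q x y \<noteq> 0. q x y * (f y - f x))"

locale bounded_rates =
  fixes q :: "'a \<Rightarrow> 'a \<Rightarrow> real" and B :: real
  assumes rate_nonneg: "\<And>x y. 0 \<le> q x y"
    and finite_targets: "\<And>x. finite {y. q x y \<noteq> 0}"
    and exit_rate_le: "\<And>x. exit_rate q x \<le> B"
begin

lemma exit_rate_eq: "exit_rate q x = (\<Sum>y\<in>{y. q x y \<noteq> 0} - {x}. q x y)"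
proof -
  have "exit_rate q x = (\<Sum>\<^sub>\<infinity>y\<in>{y. q x y \<noteq> 0} - {x}. q x y)"
    unfolding exit_rate_def by (intro infsum_cong_neutral) auto
  then show ?thesis
    using finite_targets by (simp add: infsum_finite)
qed

lemma exit_rate_nonneg: "0 \<le> exit_rate q x"
  unfolding exit_rate_eq by (intro sum_nonneg rate_nonneg)

lemma exit_rate_eq_0_iff: "exit_rate q x = 0 \<longleftrightarrow> (\<forall>y. y \<noteq> x \<longrightarrow> q x y = 0)"
  unfolding exit_rate_eq using finite_targets rate_nonneg
  by (subst sum_nonneg_eq_0_iff) auto

lemma pmf_jump_pmf:
  assumes "exit_rate q x \<noteq> 0"
  shows "pmf (jump_pmf q x) y = (if y = x then 0 else q x y / exit_rate q x)"
proof -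
  let ?f = "\<lambda>y. if y = x then 0 else q x y / exit_rate q x"
  have pos: "0 < exit_rate q x"
    using exit_rate_nonneg[of x] assms by simp
  have fin: "finite {y. ?f y \<noteq> 0}"
    by (rule finite_subset[OF _ finite_targets[of x]]) auto
  have "(\<integral>\<^sup>+y. ennreal (?f y) \<partial>count_space UNIV)
      = (\<integral>\<^sup>+y. ennreal (?f y) \<partial>count_space ({y. q x y \<noteq> 0} - {x}))"
    by (rule nn_integral_count_space_eq) auto
  also have "\<dots> = (\<Sum>y\<in>{y. q x y \<noteq> 0} - {x}. ennreal (?f y))"
    using finite_targets by (intro nn_integral_count_space_finite) auto
  also have "\<dots> = ennreal (\<Sum>y\<in>{y. q x y \<noteq> 0} - {x}. ?f y)"
    using pos rate_nonneg by (intro sum_ennreal) auto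
  also have "(\<Sum>y\<in>{y. q x y \<noteq> 0} - {x}. ?f y) = 1"
    using pos by (simp add: sum_divide_distrib[symmetric] exit_rate_eq cong: sum.cong_simp)
  finally have "(\<integral>\<^sup>+y. ennreal (?f y) \<partial>count_space UNIV) = 1"
    by simp
  then show ?thesis
    using assms pos rate_nonneg unfolding jump_pmf_def by (simp add: pmf_embed_pmf)
qed

lemma set_jump_pmf:
  "exit_rate q x \<noteq> 0 \<Longrightarrow> set_pmf (jump_pmf q x) = {y. q x y \<noteq> 0} - {x}"
  by (auto simp: set_pmf_eq pmf_jump_pmf)

lemma set_jump_pmf_subset: "set_pmf (jump_pmf q x) \<subseteq> insert x {y. x \<noteq> y \<and> 0 < q x y}"
proof (cases "exit_rate q x = 0")
  case True
  then show ?thesis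
    by (simp add: jump_pmf_def)
next
  case False
  have "0 < q x y" if "q x y \<noteq> 0" for y
    using that rate_nonneg[of x y] by simp
  then show ?thesis
    using False by (auto simp: set_jump_pmf)
qed

lemma sum_rates:
  "(\<Sum>y\<in>{y. q x y \<noteq> 0} - {x}. q x y * f y) = drift q f x + f x * exit_rate q x"
proof -
  have "drift q f x = (\<Sum>y\<in>{y. q x y \<noteq> 0} - {x}. q x y * (f y - f x))"
    unfolding drift_def using finite_targets by (intro sum.mono_neutral_right) auto
  then show ?thesis
    by (simp add: exit_rate_eq algebra_simps sum_subtractf sum_distrib_left)
qed

lemma drift_lower_bound:
  assumes "\<And>y. 0 \<le> f y"
  shows "0 \<le> drift q f x + f x * exit_rate q x"
  using assms rate_nonneg unfolding sum_rates[symmetric] by (intro sum_nonneg) auto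

lemma nn_integral_jump_pmf:
  assumes "exit_rate q x \<noteq> 0" and f: "\<And>y. 0 \<le> f y"
  shows "(\<integral>\<^sup>+y. ennreal (f y) \<partial>measure_pmf (jump_pmf q x)) = ennreal (f x + drift q f x / exit_rate q x)"
proof -
  let ?A = "{y. q x y \<noteq> 0} - {x}"
  have pos: "0 < exit_rate q x"
    using exit_rate_nonneg[of x] assms by simp
  have "(\<integral>\<^sup>+y. ennreal (f y) \<partial>measure_pmf (jump_pmf q x)) = (\<Sum>y\<in>?A. ennreal (f y) * ennreal (q x y / exit_rate q x))"
    using assms finite_targets
    by (subst nn_integral_measure_pmf_finite) (auto simp: set_jump_pmf pmf_jump_pmf)
  also have "\<dots> = (\<Sum>y\<in>?A. ennreal (f y * (q x y / exit_rate q x)))"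
    using f pos rate_nonneg by (intro sum.cong refl ennreal_mult[symmetric]) auto
  also have "\<dots> = ennreal (\<Sum>y\<in>?A. f y * (q x y / exit_rate q x))"
    using f pos rate_nonneg by (intro sum_ennreal) auto
  also have "(\<Sum>y\<in>?A. f y * (q x y / exit_rate q x)) = (\<Sum>y\<in>?A. q x y * f y) / exit_rate q x"
    by (simp add: sum_divide_distrib mult.commute)
  also note sum_rates
  finally show ?thesis
    using pos by (simp add: add_divide_distrib add.commute)
qed

lemma drift_absorbing:
  "exit_rate q x = 0 \<Longrightarrow> drift q f x = 0"
  unfolding drift_def exit_rate_eq_0_iff by (intro sum.neutral) auto

text \<open>Every visit lasts at least \<open>1 / B\<close> on average, so the expected number of
  jumps before the return is at most \<open>B\<close> times the expected return time.\<close>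

lemma suminf_survival_finite:
  assumes "positive_recurrent_state q x" and "exit_rate q x \<noteq> 0"
  shows "(\<Sum>k. survival q x k x) < \<infinity>"
proof -
  have B: "0 < B"
    using exit_rate_le[of x] exit_rate_nonneg[of x] assms(2) by simp
  let ?g = "\<lambda>y. 1 / ennreal (exit_rate q y)"
  have "1 / ennreal B \<le> ?g y" for y
    using exit_rate_le[of y] by (rule one_divide_ennreal_antimono)
  then have mono: "(taboo_op q x ^^ k) (\<lambda>_. 1 / ennreal B) z \<le> (taboo_op q x ^^ k) ?g z" for k z
    by (induction k arbitrary: z) (auto intro!: taboo_op_mono)
  have "1 / ennreal B * survival q x k x \<le> (taboo_op q x ^^ k) ?g x" for k
    using mono[of k x] fun_cong[OF funpow_taboo_op_cmult[where k=k and q=q and x=x and c="1 / ennreal B" and g="\<lambda>_. 1"], of x]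
    by (simp only: mult.right_neutral)
  then have "(\<Sum>k. 1 / ennreal B * survival q x k x) \<le> (\<Sum>k. (taboo_op q x ^^ k) ?g x)"
    by (intro suminf_le) auto
  also have "\<dots> = (\<integral>\<^sup>+\<omega>. (\<Sum>k. (if avoids x k (fst \<omega>) then ?g (fst \<omega> k) else 0) * ennreal (snd \<omega> k)) \<partial>path_measure q x)"
    by (rule nn_integral_path_avoids[symmetric])
  also have "\<dots> \<le> (\<integral>\<^sup>+\<omega>. return_time q x \<omega> \<partial>path_measure q x)"
  proof (intro nn_integral_mono)
    fix \<omega> :: "(nat \<Rightarrow> 'a) \<times> (nat \<Rightarrow> real)"
    show "(\<Sum>k. (if avoids x k (fst \<omega>) then ?g (fst \<omega> k) else 0) * ennreal (snd \<omega> k)) \<le> return_time q x \<omega>"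
      using return_time_ge[of x "fst \<omega>" "snd \<omega>" q]
      by (simp add: ennreal_divide_times if_distrib[of "\<lambda>c. c * _"] cong: if_cong)
  qed
  also have "\<dots> < \<infinity>"
    using assms by (simp add: positive_recurrent_state_def)
  finally have "1 / ennreal B * (\<Sum>k. survival q x k x) < \<infinity>"
    by simp
  moreover have "1 / ennreal B \<noteq> 0"
    by simp
  ultimately show ?thesis
    by (auto simp: ennreal_mult_less_top)
qed

text \<open>Every visit lasts at most \<open>1 / c\<close> on average. The upper bound on the return
  time is available only for paths that do return, so almost sure return is derived first.\<close>

lemma positive_recurrent_state_if_survival:
  assumes sum: "(\<Sum>k. survival q x k x) < \<infinity>"
    and c: "0 < c" "\<And>y. reachable q x y \<Longrightarrow> c \<le> exit_rate q y"
  shows "positive_recurrent_state q x"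
proof -
  let ?g = "\<lambda>y. 1 / ennreal (exit_rate q y)"
  have closed: "set_pmf (jump_pmf q z) \<subseteq> {y. reachable q x y}" if "reachable q x z" for z
    using set_jump_pmf_subset[of z] that unfolding reachable_def
    by (auto intro: rtranclp.rtrancl_into_rtrancl)
  have g: "?g y \<le> 1 / ennreal c" if "reachable q x y" for y
    using c(2)[OF that] by (rule one_divide_ennreal_antimono)
  have mono: "(taboo_op q x ^^ k) ?g z \<le> (taboo_op q x ^^ k) (\<lambda>_. 1 / ennreal c) z" if "reachable q x z" for k z
    using that
  proof (induction k arbitrary: z)
    case 0
    then show ?case
      using g by simp
  next
    case (Suc k)
    then show ?case
      using closed[of z] by (auto intro!: taboo_op_mono)
  qed
  have le: "(taboo_op q x ^^ k) ?g x \<le> 1 / ennreal c * survival q x k x" for k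
    using mono[of x k] fun_cong[OF funpow_taboo_op_cmult[where k=k and q=q and x=x and c="1 / ennreal c" and g="\<lambda>_. 1"], of x]
    by (simp only: mult.right_neutral reachable_def rtranclp.rtrancl_refl simp_thms)
  let ?f = "\<lambda>k Y. if avoids x k Y then 1 else 0 :: ennreal"
  \<comment> \<open>The number of avoiding steps has finite expectation, hence is finite almost
    surely; on a path that never returns it would be infinite.\<close>
  have fin: "AE \<omega> in path_measure q x. (\<Sum>k. ?f k (fst \<omega>)) \<noteq> \<infinity>"
  proof -
    interpret L: prob_space "jump_chain.PF.lim q x"
      by (rule prob_space_lim)
    interpret X: prob_space "PiM (UNIV :: nat set) (\<lambda>_. std_exp)"
      by (intro prob_space_PiM prob_space_std_exp)
    interpret P: pair_prob_space "jump_chain.PF.lim q x" "PiM (UNIV :: nat set) (\<lambda>_. std_exp)" ..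
    note m = measurable_avoids[where g="\<lambda>_. 1" and x=x]
    have mL [measurable]: "?f k \<in> borel_measurable (jump_chain.PF.lim q x)" for k
      using m[of k UNIV] by (simp cong: measurable_cong_sets)
    have "(\<integral>\<^sup>+Y. (\<Sum>k. ?f k Y) \<partial>jump_chain.PF.lim q x) = (\<Sum>k. survival q x k x)"
      using mL nn_integral_lim_avoids[where g="\<lambda>_. 1" and x=x and q=q] by (simp add: nn_integral_suminf)
    then have "AE Y in jump_chain.PF.lim q x. (\<Sum>k. ?f k Y) \<noteq> \<infinity>"
      using sum by (intro nn_integral_noteq_infinite borel_measurable_suminf_order mL) auto
    moreover have [measurable]: "(\<lambda>\<omega>. ?f k (fst \<omega>)) \<in> borel_measurable (path_measure q x)" for k
      by (intro measurable_fst_path m) auto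
    have "{\<omega> \<in> space (path_measure q x). (\<Sum>k. ?f k (fst \<omega>)) \<noteq> \<infinity>} \<in> sets (path_measure q x)"
      by measurable
    ultimately show ?thesis
      unfolding path_measure_def by (intro P.AE_pair_measure) auto
  qed
  have "AE \<omega> in path_measure q x. return_time q x \<omega>
      \<le> (\<Sum>k. (if avoids x k (fst \<omega>) then ?g (fst \<omega> k) else 0) * ennreal (snd \<omega> k))"
    using fin AE_path_measure_pos
  proof eventually_elim
    case (elim \<omega>)
    obtain k where "\<not> avoids x k (fst \<omega>)"
    proof (rule ccontr)
      assume *: "\<not> thesis"
      have "avoids x k (fst \<omega>)" for k
        using * that by blast
      then have "(\<Sum>k. ?f k (fst \<omega>)) = (\<Sum>k. 1)"
        by simp
      with elim(1) show False
        using summable_suminf_not_top[of "\<lambda>_. 1"] by (auto simp: summable_const_iff)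
    qed
    then show ?case
      using return_time_le[of x k "fst \<omega>" "snd \<omega>" q] elim(2)
      by (simp add: ennreal_divide_times if_distrib[of "\<lambda>c. c * _"] cong: if_cong)
  qed
  then have "(\<integral>\<^sup>+\<omega>. return_time q x \<omega> \<partial>path_measure q x) \<le> (\<Sum>k. (taboo_op q x ^^ k) ?g x)"
    unfolding nn_integral_path_avoids[symmetric] by (rule nn_integral_mono_AE)
  also have "\<dots> \<le> (\<Sum>k. 1 / ennreal c * survival q x k x)"
    using le by (intro suminf_le) auto
  also have "\<dots> < \<infinity>"
    using sum c(1) divide_ennreal[of 1 c] by (simp add: ennreal_mult_less_top)
  finally show ?thesis
    by (simp add: positive_recurrent_state_def)
qed

text \<open>Exit rates are at most \<open>B\<close>, so drift at most \<open>- B\<close> per unit of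
  time is a mean change of at most -1 per jump. Irreducibility makes every reachable
  \<open>x\<close> accessible from the exceptional set, so \<open>foster\<close> applies to each of
  them.\<close>

lemma foster_positive_recurrent:
  fixes L :: "'a \<Rightarrow> real"
  assumes F: "finite F" and L: "\<And>z. 0 \<le> L z"
    and drift: "\<And>z. reachable q x\<^sub>0 z \<Longrightarrow> z \<notin> F \<Longrightarrow> drift q L z \<le> - B"
    and irred: "\<And>z. reachable q x\<^sub>0 z \<Longrightarrow> reachable q z x\<^sub>0"
    and c: "0 < c" "\<And>z. reachable q x\<^sub>0 z \<Longrightarrow> exit_rate q x\<^sub>0 \<noteq> 0 \<Longrightarrow> c \<le> exit_rate q z"
  shows "positive_recurrent_from q x\<^sub>0"
  unfolding positive_recurrent_from_def
proof (intro allI impI)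
  fix x assume x: "reachable q x\<^sub>0 x"
  show "positive_recurrent_state q x"
  proof (cases "exit_rate q x\<^sub>0 = 0")
    case True
    with x have "x = x\<^sub>0"
      unfolding reachable_def exit_rate_eq_0_iff by (auto elim: converse_rtranclpE)
    with True show ?thesis
      by (simp add: positive_recurrent_state_def)
  next
    case False
    define R where "R = {z. reachable q x\<^sub>0 z}"
    have exit_pos: "exit_rate q z \<noteq> 0" if "z \<in> R" for z
      using c that False by (fastforce simp: R_def)
    have step: "y \<in> R" if "z \<in> R" "z \<noteq> y" "0 < q z y" for y z
      using that unfolding R_def reachable_def by (auto intro: rtranclp.rtrancl_into_rtrancl)
    have closed: "set_pmf (jump_pmf q z) \<subseteq> R" if "z \<in> R" for z
      using set_jump_pmf_subset[of z] step[OF that] that by auto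
    have conn: "reachable q z x" if "z \<in> R" for z
      using irred[of z] x that unfolding R_def reachable_def by auto
    have hit: "\<exists>k. survival q x k z < 1" if z: "z \<in> F \<inter> R" for z
    proof -
      let ?r = "\<lambda>x y. x \<noteq> y \<and> q x y > 0"
      \<comment> \<open>Since \<open>z\<close> may be \<open>x\<close> itself, a nonempty path is
        required: leave \<open>z\<close> first, then use irreducibility.\<close>
      have "?r\<^sup>+\<^sup>+ z x"
      proof -
        obtain y where y: "y \<noteq> z" "q z y \<noteq> 0"
          using exit_pos[of z] z unfolding exit_rate_eq_0_iff by auto
        then have "?r z y"
          using rate_nonneg[of z y] by auto
        moreover have "?r\<^sup>*\<^sup>* y x"
          using conn[of y] step[of z y] \<open>?r z y\<close> that unfolding reachable_def by auto
        ultimately show ?thesis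
          by (rule rtranclp_into_tranclp2)
      qed
      then have "z \<in> R \<Longrightarrow> (\<lambda>y z. z \<in> set_pmf (jump_pmf q y))\<^sup>+\<^sup>+ z x"
      proof (induction rule: converse_tranclp_induct)
        case (base z)
        then show ?case
          using exit_pos[of z] by (auto simp: set_jump_pmf)
      next
        case (step z y)
        have "y \<in> R"
          using step.hyps(1) step.prems \<open>\<And>y z. \<lbrakk>z \<in> R; z \<noteq> y; 0 < q z y\<rbrakk> \<Longrightarrow> y \<in> R\<close> by blast
        moreover have "y \<in> set_pmf (jump_pmf q z)"
          using exit_pos[of z] step.hyps(1) step.prems by (auto simp: set_jump_pmf)
        ultimately show ?case
          using step.IH by (auto intro: tranclp_into_tranclp2)
      qed
      then show ?thesis
        using z by (intro survival_less_1) auto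
    qed
    have B: "0 < B"
      using exit_rate_le[of x\<^sub>0] exit_rate_nonneg[of x\<^sub>0] False by simp
    have "(\<Sum>k. survival q x k x) < \<infinity>"
    proof (rule foster[where R=R and F="F \<inter> R" and L="\<lambda>z. ennreal (L z)"])
      fix z assume z: "z \<in> R" "z \<notin> F \<inter> R"
      have pos: "0 < exit_rate q z" "exit_rate q z \<le> B"
        using exit_pos[OF z(1)] exit_rate_nonneg[of z] exit_rate_le[of z] by auto
      have "drift q L z \<le> - B"
        using z by (intro drift) (auto simp: R_def)
      then have "drift q L z / exit_rate q z \<le> - B / exit_rate q z"
        using pos by (intro divide_right_mono) auto
      also have "\<dots> \<le> - 1"
        using pos by (simp add: field_simps)
      finally have "L z + drift q L z / exit_rate q z + 1 \<le> L z"
        by simp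
      moreover have "(\<integral>\<^sup>+y. ennreal (L y) \<partial>measure_pmf (jump_pmf q z)) = ennreal (L z + drift q L z / exit_rate q z)"
        using pos L by (intro nn_integral_jump_pmf) auto
      \<comment> \<open>As \<open>ennreal\<close> truncates negative values, nonnegativity is what
        lets \<open>+ 1\<close> move inside it.\<close>
      moreover have "0 \<le> L z + drift q L z / exit_rate q z"
        using drift_lower_bound[of L z] L pos(1) by (simp add: field_simps)
      ultimately show "(\<integral>\<^sup>+y. ennreal (L y) \<partial>measure_pmf (jump_pmf q z)) + 1 \<le> ennreal (L z)"
        by (metis ennreal_1 ennreal_leI ennreal_plus zero_le_one)
    next
      fix z assume "z \<in> F \<inter> R"
      then show "(\<integral>\<^sup>+y. ennreal (L y) \<partial>measure_pmf (jump_pmf q z)) < \<infinity>"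
        using exit_pos[of z] L by (subst nn_integral_jump_pmf) auto
    qed (use F hit closed x in \<open>auto simp: R_def\<close>)
    moreover have "c \<le> exit_rate q y" if "reachable q x y" for y
      using c(2)[of y] x that False unfolding reachable_def by (auto intro: rtranclp_trans)
    ultimately show ?thesis
      using c(1) by (intro positive_recurrent_state_if_survival[where c=c]) auto
  qed
qed

lemma not_positive_recurrent_state:
  fixes f :: "'a \<Rightarrow> real"
  assumes f: "\<And>z. 0 \<le> f z" and f0: "f x = 0"
    and drift: "\<And>z. 0 \<le> drift q f z" and drift_x: "0 < drift q f x"
    and jump: "\<And>z y. 0 < q z y \<Longrightarrow> f y \<le> f z + 1"
  shows "\<not> positive_recurrent_state q x"
proof
  assume "positive_recurrent_state q x"
  moreover have rx: "exit_rate q x \<noteq> 0"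
    using drift_x drift_absorbing by fastforce
  ultimately have fin: "(\<Sum>k. survival q x k x) < \<infinity>"
    by (intro suminf_survival_finite)
  let ?g = "\<lambda>z. ennreal (f z)"
  \<comment> \<open>Killing at \<open>x\<close> loses nothing because \<open>f\<close> vanishes
    there.\<close>
  have taboo: "taboo_op q x ?g z = (\<integral>\<^sup>+y. ennreal (f y) \<partial>measure_pmf (jump_pmf q z))" for z
    unfolding taboo_op_def by (intro nn_integral_cong) (simp add: f0)
  have sub: "?g z \<le> taboo_op q x ?g z" for z
  proof (cases "exit_rate q z = 0")
    case True
    then show ?thesis
      unfolding taboo by (simp add: jump_pmf_def)
  next
    case False
    then show ?thesis
      unfolding taboo using f drift[of z] exit_rate_nonneg[of z]
      by (subst nn_integral_jump_pmf) (auto intro!: ennreal_leI)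
  qed
  define a where "a = drift q f x / exit_rate q x"
  have a: "0 < a"
    using drift_x rx exit_rate_nonneg[of x] by (simp add: a_def)
  have ga: "taboo_op q x ?g x = ennreal a"
    unfolding taboo using rx f f0 by (subst nn_integral_jump_pmf) (auto simp: a_def)
  \<comment> \<open>The submartingale property of the stopped \<open>f\<close>; from the first jump
    on, its mean stays at least \<open>a\<close>.\<close>
  have lower: "(taboo_op q x ^^ k) ?g z \<le> (taboo_op q x ^^ Suc k) ?g z" for k z
  proof (induction k arbitrary: z)
    case 0
    then show ?case
      using sub by simp
  next
    case (Suc k)
    show ?case
      unfolding funpow.simps(2)[of "Suc k"] funpow.simps(2)[of k] o_apply
      using Suc.IH by (intro taboo_op_mono) simp
  qed
  have a_le: "ennreal a \<le> (taboo_op q x ^^ Suc k) ?g x" for k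
  proof (induction k)
    case 0
    then show ?case by (simp add: ga)
  next
    case (Suc k)
    then show ?case
      using lower by (rule order_trans)
  qed
  \<comment> \<open>Each jump raises \<open>f\<close> by at most 1, so on survival its value after
    \<open>k\<close> jumps is at most \<open>f z + k\<close>.\<close>
  have upper: "(taboo_op q x ^^ k) ?g z \<le> ennreal (f z + real k) * survival q x k z" for k z
  proof (induction k arbitrary: z)
    case 0
    then show ?case by simp
  next
    case (Suc k)
    have "(taboo_op q x ^^ Suc k) ?g z \<le> taboo_op q x (\<lambda>y. ennreal (f z + real (Suc k)) * survival q x k y) z"
      unfolding funpow.simps(2) o_apply
    proof (rule taboo_op_mono)
      fix y assume "y \<in> set_pmf (jump_pmf q z)"
      then have "f y \<le> f z + 1"
        using set_jump_pmf_subset[of z] jump by force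
      then show "(taboo_op q x ^^ k) ?g y \<le> ennreal (f z + real (Suc k)) * survival q x k y"
        by (intro order_trans[OF Suc.IH] mult_right_mono ennreal_leI) auto
    qed
    then show ?case
      by (simp add: taboo_op_cmult)
  qed
  define s where "s k = enn2real (survival q x k x)" for k
  have s: "survival q x k x = ennreal (s k)" "0 \<le> s k" for k
    using le_less_trans[OF survival_le_1[where q=q and x=x and k=k and z=x], of \<top>] by (auto simp: s_def)
  have le: "a / real (Suc k) \<le> s (Suc k)" for k
  proof -
    have "ennreal a \<le> ennreal (real (Suc k)) * ennreal (s (Suc k))"
      using order_trans[OF a_le upper, of k] f0 s(1)[of "Suc k"] by (simp del: funpow.simps)
    then have "a \<le> real (Suc k) * s (Suc k)"
      using s(2) by (simp add: ennreal_mult[symmetric] ennreal_le_iff del: of_nat_Suc)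
    then show ?thesis
      by (simp add: field_simps del: of_nat_Suc)
  qed
  have "summable s"
    using fin s by (intro summable_suminf_not_top) auto
  then have "summable (\<lambda>k. s (Suc k))"
    by (simp add: summable_Suc_iff)
  then have "summable (\<lambda>k. a / real (Suc k))"
  proof (rule summable_comparison_test')
    show "norm (a / real (Suc k)) \<le> s (Suc k)" if "0 \<le> k" for k
      using le[of k] a by (simp del: of_nat_Suc)
  qed
  then have "summable (\<lambda>k. 1 / a * (a / real (Suc k)))"
    by (rule summable_mult)
  then have "summable (\<lambda>k. inverse (real (Suc k)))"
    using a by (simp add: field_simps)
  then show False
    using not_summable_harmonic[where 'a=real] summable_Suc_iff[of "\<lambda>n. inverse (real n)"] by simp
qed

end

section \<open>Trees\<close>

text \<open>In a tree, this is the component of \<open>u\<close> after removal of the edge between \<open>u\<close> and \<open>v\<close>.\<close>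

definition side :: "('v \<times> 'v) set \<Rightarrow> 'v \<Rightarrow> 'v \<Rightarrow> 'v set" where
  "side E u v = {s. (s, u) \<in> (E - {(u, v), (v, u)})\<^sup>*}"

lemma rtrancl_simple_path:
  assumes "(a, b) \<in> R\<^sup>*"
  shows "\<exists>p. p \<noteq> [] \<and> hd p = a \<and> last p = b \<and> distinct p \<and> successively (\<lambda>x y. (x, y) \<in> R) p"
  using assms
proof (induction rule: converse_rtrancl_induct)
  case base
  show ?case
    by (rule exI[of _ "[b]"]) simp
next
  case (step a c)
  then obtain p where p: "p \<noteq> []" "hd p = c" "last p = b" "distinct p" "successively (\<lambda>x y. (x, y) \<in> R) p"
    by blast
  show ?case
  proof (cases "a \<in> set p")
    \<comment> \<open>The path already visits \<open>a\<close>: cut off everything before that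
      visit.\<close>
    case True
    then obtain xs ys where "p = xs @ a # ys"
      by (auto simp: in_set_conv_decomp)
    then show ?thesis
      using p by (intro exI[of _ "a # ys"]) (auto simp: successively_append_iff)
  next
    case False
    then show ?thesis
      using p step.hyps(1) by (intro exI[of _ "a # p"]) (auto simp: successively_Cons)
  qed
qed

lemma rtrancl_leaves_set:
  assumes "(a, b) \<in> R\<^sup>*" "a \<in> A" "b \<notin> A"
  shows "\<exists>x y. (x, y) \<in> R \<and> x \<in> A \<and> y \<notin> A"
  using assms by (induction rule: converse_rtrancl_induct) auto

locale tree =
  fixes V :: "'v set" and E :: "('v \<times> 'v) set"
  assumes finite_V: "finite V" and tree: "tree_structure V E"
begin

lemma edge:
  assumes "(u, v) \<in> E"
  shows "u \<in> V" "v \<in> V" "u \<noteq> v" "(v, u) \<in> E"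
proof -
  obtain T where T: "undirected_tree V T" "E = {(u, v). {u, v} \<in> T}"
    using tree by (auto simp: tree_structure_def)
  with assms have "{u, v} \<in> T" "{u, v} \<subseteq> V" "card {u, v} = 2"
    by (auto simp: undirected_tree_def)
  then show "u \<in> V" "v \<in> V" "u \<noteq> v" "(v, u) \<in> E"
    using T(2) by (auto simp: insert_commute)
qed

lemma finite_E: "finite E"
  by (rule finite_subset[of _ "V \<times> V"]) (use edge finite_V in auto)

lemma connected: "u \<in> V \<Longrightarrow> v \<in> V \<Longrightarrow> (u, v) \<in> E\<^sup>*"
  using tree by (auto simp: tree_structure_def undirected_tree_def)

lemma tail_in_side [simp]: "u \<in> side E u v"
  by (simp add: side_def)

text \<open>Otherwise a simple path from \<open>v\<close> to \<open>u\<close> avoiding the edge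
  would exist, and the edge would close it to a cycle.\<close>

lemma head_notin_side:
  assumes uv: "(u, v) \<in> E"
  shows "v \<notin> side E u v"
proof
  let ?R = "E - {(u, v), (v, u)}"
  obtain T where T: "undirected_tree V T" "E = {(u, v). {u, v} \<in> T}"
    using tree by (auto simp: tree_structure_def)
  assume "v \<in> side E u v"
  then obtain p where p: "p \<noteq> []" "hd p = v" "last p = u" "distinct p" "successively (\<lambda>x y. (x, y) \<in> ?R) p"
    using rtrancl_simple_path[of v u ?R] by (auto simp: side_def)
  \<comment> \<open>Length 1 would force \<open>u = v\<close>, and length 2 would use the removed
    edge itself.\<close>
  have "length p \<noteq> 1"
    using p edge[OF uv] by (auto simp: length_Suc_conv)
  moreover have "length p \<noteq> 2"
    using p by (auto simp: length_Suc_conv numeral_2_eq_2)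
  ultimately have "3 \<le> length p"
    using p(1) by (cases p; cases "tl p"; cases "tl (tl p)") auto
  moreover have "{p ! i, p ! Suc i} \<in> T" if "Suc i < length p" for i
    using p(5) that T(2) by (auto simp: successively_conv_nth)
  moreover have "{last p, hd p} \<in> T"
    using p uv T(2) by simp
  ultimately have "is_cycle T p"
    using p(4) by (simp add: is_cycle_def)
  then show False
    using T(1) by (auto simp: undirected_tree_def)
qed

lemma side_subset: "(u, v) \<in> E \<Longrightarrow> side E u v \<subseteq> V"
  unfolding side_def using edge(1) by (auto elim: converse_rtranclE)

lemma side_psubset: "(u, v) \<in> E \<Longrightarrow> side E u v \<subset> V"
  using side_subset head_notin_side edge(2) by blast

text \<open>Any other edge survives the removal, so with one endpoint it has both endpoints in the
  component.\<close>

lemma edge_leaving_side: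
  assumes "(u, v) \<in> E" "(a, b) \<in> E" "a \<in> side E u v" "b \<notin> side E u v"
  shows "a = u" "b = v"
proof -
  have "\<not> (b, a) \<in> E - {(u, v), (v, u)}"
    using assms(3,4) unfolding side_def by (auto intro: converse_rtrancl_into_rtrancl)
  then have "(b, a) \<in> {(u, v), (v, u)}"
    using edge(4)[OF assms(2)] by blast
  moreover have "b \<noteq> u"
    using assms(4) by auto
  ultimately show "a = u" "b = v"
    by auto
qed

text \<open>By symmetry, paths from \<open>s\<close> to \<open>u\<close> and to \<open>v\<close>
  would join to a path from \<open>v\<close> to \<open>u\<close> avoiding the edge.\<close>

lemma side_disjoint:
  assumes "(u, v) \<in> E" "s \<in> side E u v"
  shows "s \<notin> side E v u"
proof
  let ?R = "E - {(u, v), (v, u)}"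
  assume "s \<in> side E v u"
  then have "(s, v) \<in> ?R\<^sup>*"
    by (simp add: side_def insert_commute)
  moreover have "sym ?R"
    using edge(4) by (auto simp: sym_def)
  ultimately have "(v, s) \<in> ?R\<^sup>*"
    by (meson symD sym_rtrancl)
  then have "v \<in> side E u v"
    using assms(2) by (auto simp: side_def)
  then show False
    using head_notin_side assms(1) by blast
qed

text \<open>Take \<open>w\<close> to be the last node before a path from \<open>s\<close> first
  enters \<open>b\<close>. The path up to \<open>w\<close> avoids \<open>b\<close>, hence also the
  edge between \<open>w\<close> and \<open>b\<close>.\<close>

lemma ex_incoming_side:
  assumes "s \<in> V" "b \<in> V" "s \<noteq> b"
  shows "\<exists>w. (w, b) \<in> E \<and> s \<in> side E w b"
proof -
  have "s = b \<or> (\<exists>w. (w, b) \<in> E \<and> (s, w) \<in> {(x, y) \<in> E. x \<noteq> b \<and> y \<noteq> b}\<^sup>*)"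
    using connected[OF assms(1,2)]
  proof (induction rule: converse_rtrancl_induct)
    case (step s t)
    then show ?case
    proof (cases "s = b \<or> t = b")
      case True
      then show ?thesis
        using step.hyps(1) by auto
    next
      case False
      then show ?thesis
        using step by (auto intro: converse_rtrancl_into_rtrancl)
    qed
  qed simp
  then obtain w where w: "(w, b) \<in> E" "(s, w) \<in> {(x, y) \<in> E. x \<noteq> b \<and> y \<noteq> b}\<^sup>*"
    using assms(3) by blast
  have "(s, w) \<in> (E - {(w, b), (b, w)})\<^sup>*"
    using w(2) by (rule rtrancl_mono[THEN subsetD, rotated]) auto
  with w(1) show ?thesis
    by (auto simp: side_def)
qed

lemma ex_incoming_side_other:
  assumes "(u, v) \<in> E" "s \<in> side E u v" "s \<noteq> u"
  shows "\<exists>w. (w, u) \<in> E \<and> w \<noteq> v \<and> s \<in> side E w u"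
  using ex_incoming_side[of s u] side_subset[OF assms(1)] edge[OF assms(1)] side_disjoint[OF assms(1,2)] assms
  by blast

text \<open>A path to \<open>w\<close> inside its side never touches \<open>u\<close>, so it
  survives removal of the edge between \<open>u\<close> and \<open>v\<close>. Strict growth of sides
  along directed paths makes the upstream relation acyclic.\<close>

lemma side_mono:
  assumes wu: "(w, u) \<in> E" and uv: "(u, v) \<in> E" and "w \<noteq> v"
  shows "side E w u \<subset> side E u v"
proof
  have "(w, u) \<in> E - {(u, v), (v, u)}"
    using wu uv \<open>w \<noteq> v\<close> edge(3) by auto
  then have w: "w \<in> side E u v"
    by (auto simp: side_def)
  show "side E w u \<subseteq> side E u v"
  proof
    fix s assume "s \<in> side E w u"
    then have "(s, w) \<in> (E - {(w, u), (u, w)})\<^sup>*"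
      by (simp add: side_def)
    then show "s \<in> side E u v"
    proof (induction rule: converse_rtrancl_induct)
      case (step s t)
      have "t \<noteq> v" "t \<noteq> u"
        using step head_notin_side[OF uv] head_notin_side[OF wu] by (auto simp: side_def)
      then have "(s, t) \<in> E - {(u, v), (v, u)}"
        using step by auto
      then show ?case
        using step.IH unfolding side_def by (auto intro: converse_rtrancl_into_rtrancl)
    qed (rule w)
  qed
  show "side E w u \<noteq> side E u v"
    using head_notin_side[OF wu] tail_in_side[of u v] by blast
qed

lemma cut_side:
  assumes "(u, v) \<in> E"
  shows "{(a, b) \<in> E. a \<in> side E u v \<and> b \<notin> side E u v} = {(u, v)}"
  using edge_leaving_side[OF assms] head_notin_side[OF assms] assms by auto

end

section \<open>The network\<close>

abbreviation cnt :: "('a \<Rightarrow> bool) \<Rightarrow> 'a list \<Rightarrow> nat" where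
  "cnt P x \<equiv> length (filter P x)"

text \<open>The additive form avoids subtraction on \<open>nat\<close>.\<close>

lemma cnt_list_update:
  "i < length x \<Longrightarrow> cnt P (x[i := p]) + of_bool (P (x ! i)) = cnt P x + of_bool (P p)"
proof (induction x arbitrary: i)
  case (Cons a x)
  then show ?case
    by (cases i) (auto split: if_splits)
qed simp

lemma cnt_le_sum:
  assumes "finite I" "\<And>p. p \<in> set x \<Longrightarrow> P p \<Longrightarrow> \<exists>i\<in>I. Q i p"
  shows "cnt P x \<le> (\<Sum>i\<in>I. cnt (Q i) x)"
  using assms(2)
proof (induction x)
  case (Cons a x)
  have IH: "cnt P x \<le> (\<Sum>i\<in>I. cnt (Q i) x)"
    using Cons by auto
  have "(if P a then 1 else 0) \<le> (\<Sum>i\<in>I. if Q i a then 1 else 0::nat)"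
  proof (cases "P a")
    case True
    then obtain i where "i \<in> I" "Q i a"
      using Cons.prems by auto
    then show ?thesis
      using assms(1) member_le_sum[of i I "\<lambda>i. if Q i a then 1 else 0::nat"] by auto
  qed simp
  moreover have "(\<Sum>i\<in>I. cnt (Q i) (a # x)) = (\<Sum>i\<in>I. if Q i a then 1 else 0) + (\<Sum>i\<in>I. cnt (Q i) x)"
    by (subst sum.distrib[symmetric]) (auto intro!: sum.cong)
  moreover have "cnt P (a # x) = (if P a then 1 else 0) + cnt P x"
    by simp
  ultimately show ?case
    using IH by linarith
qed simp

lemma pmf_expectation_le_const:
  assumes "finite (set_pmf p)" "\<And>x. x \<in> set_pmf p \<Longrightarrow> f x \<le> (c::real)"
  shows "measure_pmf.expectation p f \<le> c"
  using assms
  by (intro measure_pmf.integral_le_const) (auto simp: AE_measure_pmf_iff integrable_measure_pmf_finite)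

lemma pmf_expectation_ge_const:
  assumes "finite (set_pmf p)" "\<And>x. x \<in> set_pmf p \<Longrightarrow> (c::real) \<le> f x"
  shows "c \<le> measure_pmf.expectation p f"
  using assms
  by (intro measure_pmf.integral_ge_const) (auto simp: AE_measure_pmf_iff integrable_measure_pmf_finite)

text \<open>Departures are invisible to predicates that fail on fully available packets, so counts
  after an arrival or a transmission can be computed as if nothing left.\<close>

lemma cnt_depart:
  "(\<And>p. P p \<Longrightarrow> \<not> V \<subseteq> snd p) \<Longrightarrow> cnt P (depart V x) = cnt P x"
  unfolding depart_def by (auto intro!: arg_cong[where f=length] filter_cong)

lemma cnt_arrive:
  assumes "\<And>p. P p \<Longrightarrow> \<not> V \<subseteq> snd p"
  shows "cnt P (arrive V u x) = cnt P x + of_bool (P (u, {u}))"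
  unfolding arrive_def using assms by (subst cnt_depart) auto

lemma cnt_transmit:
  assumes "\<And>p. P p \<Longrightarrow> \<not> V \<subseteq> snd p" and "i < length x"
  shows "cnt P (transmit V v x (Some i)) + of_bool (P (x ! i))
    = cnt P x + of_bool (P (fst (x ! i), insert v (snd (x ! i))))"
  using cnt_list_update[OF assms(2)] assms(1) by (simp add: cnt_depart)

section \<open>The network chain and its generator\<close>

locale network = tree V E for V :: "'v set" and E :: "('v \<times> 'v) set" +
  fixes arr :: "'v \<Rightarrow> real" and cap :: "'v \<times> 'v \<Rightarrow> real" and D :: "'v discipline"
  assumes arr_nonneg: "\<And>u. u \<in> V \<Longrightarrow> 0 \<le> arr u"
    and cap_pos: "\<And>e. e \<in> E \<Longrightarrow> 0 < cap e"
    and discipline: "is_discipline E D"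
begin

lemma cap_nonneg: "e \<in> E \<Longrightarrow> 0 \<le> cap e"
  using cap_pos by (rule less_imp_le)

abbreviation q :: "'v state \<Rightarrow> 'v state \<Rightarrow> real" where
  "q \<equiv> network_rate V E arr cap D"

abbreviation total_rate :: real where
  "total_rate \<equiv> sum arr V + sum cap E"

lemma chosen_useful: "e \<in> E \<Longrightarrow> Some i \<in> set_pmf (D x e) \<Longrightarrow> useful x e i"
  using discipline by (auto simp: is_discipline_def)

lemma finite_choice:
  assumes "e \<in> E"
  shows "finite (set_pmf (D x e))"
proof (rule finite_subset)
  show "set_pmf (D x e) \<subseteq> insert None (Some ` {..<length x})"
  proof
    fix o' assume "o' \<in> set_pmf (D x e)"
    then show "o' \<in> insert None (Some ` {..<length x})"
      using chosen_useful[OF assms] by (cases o') (auto simp: useful_def)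
  qed
qed simp

text \<open>A finite superset of the support of \<open>q x\<close>; it may contain \<open>x\<close>
  itself and states of rate zero.\<close>

definition targets :: "'v state \<Rightarrow> 'v state set" where
  "targets x = (\<lambda>u. arrive V u x) ` V \<union> (\<Union>e\<in>E. transmit V (snd e) x ` set_pmf (D x e))"

lemma finite_target_states: "finite (targets x)"
  unfolding targets_def using finite_V finite_E finite_choice by auto

lemma rate_support: "{y. q x y \<noteq> 0} \<subseteq> targets x"
proof -
  have "q x y = 0" if y: "y \<notin> targets x" for y
  proof -
    have "(\<Sum>u\<in>V. if arrive V u x = y then arr u else 0) = 0"
      using y by (intro sum.neutral) (auto simp: targets_def)
    moreover have "(\<Sum>e\<in>E. cap e * pmf (map_pmf (transmit V (snd e) x) (D x e)) y) = 0"
    proof (intro sum.neutral ballI)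
      fix e assume "e \<in> E"
      then have "y \<notin> set_pmf (map_pmf (transmit V (snd e) x) (D x e))"
        using y by (auto simp: targets_def)
      then show "cap e * pmf (map_pmf (transmit V (snd e) x) (D x e)) y = 0"
        by (simp only: set_pmf_iff not_not mult_zero_right)
    qed
    ultimately show ?thesis
      by (simp only: network_rate_def add_0)
  qed
  then show ?thesis
    by blast
qed

lemma network_rate_nonneg: "0 \<le> q x y"
  unfolding network_rate_def
  using arr_nonneg cap_pos[THEN less_imp_le]
  by (intro add_nonneg_nonneg sum_nonneg mult_nonneg_nonneg pmf_nonneg) auto

text \<open>Grouping by event instead of by target state: several events may lead to the same state,
  and exchanging the sums accounts for that.\<close>

lemma sum_targets:
  "(\<Sum>y\<in>targets x. q x y * g y) = (\<Sum>u\<in>V. arr u * g (arrive V u x))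
    + (\<Sum>e\<in>E. cap e * measure_pmf.expectation (D x e) (\<lambda>i. g (transmit V (snd e) x i)))"
proof -
  let ?p = "\<lambda>e. map_pmf (transmit V (snd e) x) (D x e)"
  have "(\<Sum>y\<in>targets x. q x y * g y) = (\<Sum>y\<in>targets x. \<Sum>u\<in>V. if arrive V u x = y then arr u * g y else 0)
      + (\<Sum>y\<in>targets x. \<Sum>e\<in>E. cap e * (pmf (?p e) y * g y))"
    by (simp add: network_rate_def distrib_right sum.distrib sum_distrib_right if_distrib[of "\<lambda>c. c * _"]
        mult.assoc cong: if_cong)
  also have "(\<Sum>y\<in>targets x. \<Sum>u\<in>V. if arrive V u x = y then arr u * g y else 0)
      = (\<Sum>u\<in>V. \<Sum>y\<in>targets x. if arrive V u x = y then arr u * g y else 0)"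
    by (rule sum.swap)
  also have "\<dots> = (\<Sum>u\<in>V. arr u * g (arrive V u x))"
    by (rule sum.cong) (auto simp: sum.delta' finite_target_states, auto simp: targets_def)
  also have "(\<Sum>y\<in>targets x. \<Sum>e\<in>E. cap e * (pmf (?p e) y * g y))
      = (\<Sum>e\<in>E. \<Sum>y\<in>targets x. cap e * (pmf (?p e) y * g y))"
    by (rule sum.swap)
  also have "\<dots> = (\<Sum>e\<in>E. cap e * measure_pmf.expectation (D x e) (\<lambda>i. g (transmit V (snd e) x i)))"
  proof (rule sum.cong[OF refl])
    fix e assume "e \<in> E"
    then have "set_pmf (?p e) \<subseteq> targets x"
      by (auto simp: targets_def)
    then have "measure_pmf.expectation (?p e) g = (\<Sum>y\<in>targets x. pmf (?p e) y * g y)"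
      by (subst integral_measure_pmf[OF finite_target_states]) auto
    then show "(\<Sum>y\<in>targets x. cap e * (pmf (?p e) y * g y))
        = cap e * measure_pmf.expectation (D x e) (\<lambda>i. g (transmit V (snd e) x i))"
      by (simp add: sum_distrib_left)
  qed
  finally show ?thesis .
qed

lemma exit_rate_sum:
  "exit_rate q x = (\<Sum>u\<in>V. arr u * of_bool (arrive V u x \<noteq> x))
    + (\<Sum>e\<in>E. cap e * measure_pmf.expectation (D x e) (\<lambda>i. of_bool (transmit V (snd e) x i \<noteq> x)))"
proof -
  have "exit_rate q x = (\<Sum>\<^sub>\<infinity>y\<in>targets x. q x y * of_bool (y \<noteq> x))"
    unfolding exit_rate_def
  proof (rule infsum_cong_neutral)
    fix y assume "y \<in> - {x} - targets x"
    then show "q x y = 0"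
      using rate_support[of x] by blast
  qed simp_all
  also have "\<dots> = (\<Sum>y\<in>targets x. q x y * of_bool (y \<noteq> x))"
    by (rule infsum_finite[OF finite_target_states])
  also note sum_targets
  finally show ?thesis .
qed

sublocale bounded_rates q total_rate
proof
  fix x y :: "'v state"
  show "0 \<le> q x y"
    by (rule network_rate_nonneg)
  show "finite {y. q x y \<noteq> 0}"
    by (rule finite_subset[OF rate_support finite_target_states])
  have "arr u * of_bool (arrive V u x \<noteq> x) \<le> arr u" if "u \<in> V" for u
    using arr_nonneg[OF that] by simp
  moreover have "cap e * measure_pmf.expectation (D x e) (\<lambda>i. of_bool (transmit V (snd e) x i \<noteq> x)) \<le> cap e"
    if "e \<in> E" for e
    using cap_pos[OF that] finite_choice[OF that]
      pmf_expectation_le_const[of "D x e" "\<lambda>i. of_bool (transmit V (snd e) x i \<noteq> x)" 1]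
    by (simp add: mult_left_le)
  ultimately show "exit_rate q x \<le> total_rate"
    unfolding exit_rate_sum by (intro add_mono sum_mono) auto
qed

lemma drift_eq:
  "drift q f x = (\<Sum>u\<in>V. arr u * (f (arrive V u x) - f x))
    + (\<Sum>e\<in>E. cap e * measure_pmf.expectation (D x e) (\<lambda>i. f (transmit V (snd e) x i) - f x))"
proof -
  have "drift q f x = (\<Sum>y\<in>targets x. q x y * (f y - f x))"
    unfolding drift_def using rate_support finite_target_states by (intro sum.mono_neutral_left) auto
  then show ?thesis
    by (simp add: sum_targets)
qed

section \<open>Necessity of the cut condition\<close>

lemma not_stable:
  assumes S: "S \<subset> V" and pos: "0 < sum arr S"
    and ge: "(\<Sum>(u, v) \<in> {(u, v) \<in> E. u \<in> S \<and> v \<notin> S}. cap (u, v)) \<le> sum arr S"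
  shows "\<not> network_stable V E arr cap D"
proof -
  define P where "P p \<longleftrightarrow> snd p \<subseteq> S" for p :: "'v packet"
  define f where "f x = real (cnt P x)" for x
  have P: "\<not> V \<subseteq> snd p" if "P p" for p
    using that S by (auto simp: P_def)
  have arrive: "f (arrive V u x) = f x + of_bool (u \<in> S)" for u x
    using cnt_arrive[of P V, OF P] by (simp add: f_def P_def)
  \<comment> \<open>A transmission lowers the count only if it carries a confined packet across a
    link leaving \<open>S\<close>, and then by one.\<close>
  have transmit: "f (transmit V (snd e) x i) - f x \<le> 0 \<and>
      - of_bool (fst e \<in> S \<and> snd e \<notin> S) \<le> f (transmit V (snd e) x i) - f x"
    if "e \<in> E" "i \<in> set_pmf (D x e)" for e x i
  proof (cases i)
    case (Some j)
    then have "useful x e j"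
      using that chosen_useful by auto
    then have j: "j < length x" "fst e \<in> snd (x ! j)"
      by (auto simp: useful_def)
    let ?p = "(fst (x ! j), insert (snd e) (snd (x ! j)))"
    have "real (cnt P (transmit V (snd e) x i) + of_bool (P (x ! j))) = real (cnt P x + of_bool (P ?p))"
      using cnt_transmit[of P V j x "snd e", OF P] j(1) unfolding Some by simp
    then have "f (transmit V (snd e) x i) - f x = of_bool (P ?p) - of_bool (P (x ! j))"
      by (simp add: f_def)
    then show ?thesis
      using j(2) by (auto simp: P_def)
  qed simp
  have arrivals: "(\<Sum>u\<in>V. arr u * (f (arrive V u x) - f x)) = sum arr S" for x
  proof -
    have "(\<Sum>u\<in>V. arr u * (f (arrive V u x) - f x)) = (\<Sum>u\<in>V. if u \<in> S then arr u else 0)"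
      by (intro sum.cong) (auto simp: arrive)
    also have "\<dots> = sum arr S"
      using S finite_V by (subst sum.inter_restrict[symmetric]) (auto simp: Int_absorb1)
    finally show ?thesis .
  qed
  have drift: "0 \<le> drift q f x" for x
  proof -
    have "(\<Sum>(u, v) \<in> {(u, v) \<in> E. u \<in> S \<and> v \<notin> S}. cap (u, v)) = (\<Sum>e\<in>E. cap e * of_bool (fst e \<in> S \<and> snd e \<notin> S))"
      using finite_E by (intro sum.mono_neutral_cong_left) auto
    moreover have "(\<Sum>e\<in>E. cap e * (- of_bool (fst e \<in> S \<and> snd e \<notin> S)))
        \<le> (\<Sum>e\<in>E. cap e * measure_pmf.expectation (D x e) (\<lambda>i. f (transmit V (snd e) x i) - f x))"
      using cap_pos transmit finite_choice
      by (intro sum_mono mult_left_mono pmf_expectation_ge_const) (auto intro: less_imp_le)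
    ultimately show ?thesis
      using ge unfolding drift_eq arrivals by (simp add: sum_negf)
  qed
  \<comment> \<open>In the empty state nothing can be transmitted, so the drift equals the arrival
    rate into \<open>S\<close>.\<close>
  have drift0: "0 < drift q f []"
  proof -
    have "measure_pmf.expectation (D [] e) (\<lambda>i. f (transmit V (snd e) [] i) - f []) = 0" if "e \<in> E" for e
    proof -
      have none: "i = None" if "i \<in> set_pmf (D [] e)" for i
        using chosen_useful[OF \<open>e \<in> E\<close>, of _ "[]"] that by (cases i) (auto simp: useful_def)
      then have "measure_pmf.expectation (D [] e) (\<lambda>i. f (transmit V (snd e) [] i) - f [])
          = measure_pmf.expectation (D [] e) (\<lambda>i. 0)"
        by (intro integral_cong_AE) (auto simp: AE_measure_pmf_iff dest!: none)
      then show ?thesis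
        by simp
    qed
    then show ?thesis
      unfolding drift_eq arrivals using pos by simp
  qed
  have "f y \<le> f z + 1" if "0 < q z y" for z y
  proof -
    have "y \<in> targets z"
      using that rate_support[of z] by auto
    then show ?thesis
      using arrive[of _ z] transmit[of _ _ z] unfolding targets_def by fastforce
  qed
  then have "\<not> positive_recurrent_state q []"
    using drift drift0 by (intro not_positive_recurrent_state[of f]) (auto simp: f_def)
  then show ?thesis
    unfolding network_stable_def positive_recurrent_from_def reachable_def by blast
qed

section \<open>Packets that still have to cross a link\<close>

definition pending :: "'v \<times> 'v \<Rightarrow> 'v packet \<Rightarrow> bool" where
  "pending e p \<longleftrightarrow> fst p \<in> side E (fst e) (snd e) \<and> snd e \<notin> snd p"

text \<open>The last clause says that a packet entering the head of a link from the side of its tail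
  has to use that link.\<close>

definition good :: "'v packet \<Rightarrow> bool" where
  "good p \<longleftrightarrow> fst p \<in> snd p \<and> snd p \<subset> V \<and>
    (\<forall>e\<in>E. pending e p \<longrightarrow> snd p \<subseteq> side E (fst e) (snd e))"

definition good_state :: "'v state \<Rightarrow> bool" where
  "good_state x \<longleftrightarrow> (\<forall>p\<in>set x. good p)"

lemma good_side:
  "good p \<Longrightarrow> e \<in> E \<Longrightarrow> pending e p \<Longrightarrow> w \<in> snd p \<Longrightarrow> w \<in> side E (fst e) (snd e)"
  by (auto simp: good_def)

lemma pending_not_full: "e \<in> E \<Longrightarrow> pending e p \<Longrightarrow> \<not> V \<subseteq> snd p"
  using edge(2)[of "fst e" "snd e"] by (auto simp: pending_def)

lemma good_depart:
  assumes "\<And>p. p \<in> set x \<Longrightarrow> \<not> V \<subseteq> snd p \<Longrightarrow> good p"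
  shows "good_state (depart V x)"
  using assms by (auto simp: good_state_def depart_def)

lemma good_arrive:
  assumes "good_state x" "u \<in> V"
  shows "good_state (arrive V u x)"
  unfolding arrive_def
  using assms by (intro good_depart) (auto simp: good_state_def good_def pending_def)

text \<open>A packet missing at \<open>snd e\<close> is pending on the link entering
  \<open>snd e\<close> from the side of its source. As a good packet it is confined to that side,
  which only that link leaves; since the packet is at \<open>fst e\<close>, that link is
  \<open>e\<close>.\<close>

lemma pending_transmitted_iff:
  assumes p: "good p" and e: "e \<in> E" and e': "e' \<in> E"
    and useful: "fst e \<in> snd p" "snd e \<notin> snd p"
  shows "pending e' p \<and> \<not> pending e' (fst p, insert (snd e) (snd p)) \<longleftrightarrow> e' = e"
proof -
  have uniq: "e' = e" if "e' \<in> E" "pending e' p" "snd e' = snd e" for e'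
  proof -
    have "fst e \<in> side E (fst e') (snd e')"
      using good_side[OF p] that useful by blast
    then have "fst e = fst e'"
      using edge_leaving_side(1)[of "fst e'" "snd e'" "fst e" "snd e"] that e
        head_notin_side[of "fst e'" "snd e'"] by (cases e') auto
    then show ?thesis
      using that by (simp add: prod_eq_iff)
  qed
  have "fst p \<in> V" "snd e \<in> V" "fst p \<noteq> snd e"
    using p e useful edge(2)[of "fst e" "snd e"] by (auto simp: good_def)
  then obtain w where w: "(w, snd e) \<in> E" "fst p \<in> side E w (snd e)"
    using ex_incoming_side by blast
  then have "pending (w, snd e) p"
    using useful by (simp add: pending_def)
  then have "pending e p"
    using uniq[of "(w, snd e)"] w by auto
  then show ?thesis
    using uniq[OF e'] useful by (auto simp: pending_def)
qed

lemma pending_transmit: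
  assumes p: "good p" and e: "e \<in> E" and e': "e' \<in> E"
    and useful: "fst e \<in> snd p" "snd e \<notin> snd p"
  shows "(of_bool (pending e' p) :: nat) = of_bool (pending e' (fst p, insert (snd e) (snd p))) + of_bool (e' = e)"
proof -
  have "pending e' (fst p, insert (snd e) (snd p)) \<Longrightarrow> pending e' p"
    by (auto simp: pending_def)
  then show ?thesis
    using pending_transmitted_iff[OF assms] by auto
qed

text \<open>If the packet is still pending on \<open>e'\<close>, then \<open>e\<close> does not end
  at \<open>snd e'\<close>. As \<open>e'\<close> is the only link leaving its side,
  \<open>snd e\<close> lies in the side of \<open>e'\<close> along with
  \<open>fst e\<close>.\<close>

lemma good_transmit:
  assumes x: "good_state x" and e: "e \<in> E" and useful: "useful x e i"
  shows "good_state (transmit V (snd e) x (Some i))"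
proof -
  define p where "p = x ! i"
  have i: "i < length x" "fst e \<in> snd p" "snd e \<notin> snd p" and p: "good p"
    using useful x by (auto simp: useful_def p_def good_state_def)
  let ?p = "(fst p, insert (snd e) (snd p))"
  have "good ?p" if "\<not> V \<subseteq> snd ?p"
  proof -
    have "snd ?p \<subseteq> side E (fst e') (snd e')" if e': "e' \<in> E" and pend: "pending e' ?p" for e'
    proof -
      have "pending e' p"
        using pend by (auto simp: pending_def)
      then have sub: "snd p \<subseteq> side E (fst e') (snd e')"
        using good_side[OF p e'] by blast
      then have "fst e \<in> side E (fst e') (snd e')"
        using i(2) by blast
      moreover have "snd e \<noteq> snd e'"
        using pend by (auto simp: pending_def)
      ultimately have "snd e \<in> side E (fst e') (snd e')"
        using edge_leaving_side(2)[of "fst e'" "snd e'" "fst e" "snd e"] e e' by (metis prod.collapse)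
      with sub show ?thesis
        by simp
    qed
    then show ?thesis
      using p e that edge(2)[of "fst e" "snd e"] by (auto simp: good_def)
  qed
  note new = this
  have "good p'" if "p' \<in> set (x[i := ?p])" "\<not> V \<subseteq> snd p'" for p'
  proof -
    have "p' = ?p \<or> p' \<in> set x"
      using that(1) set_update_subset_insert[of x i ?p] by blast
    then show ?thesis
      using new that(2) x unfolding good_state_def by blast
  qed
  then show ?thesis
    unfolding p_def[symmetric] transmit.simps by (intro good_depart) (auto simp: p_def)
qed

lemma good_step:
  assumes x: "good_state x" and "0 < q x y"
  shows "good_state y"
proof -
  have "y \<in> targets x"
    using assms(2) rate_support[of x] by auto
  then consider u where "u \<in> V" "y = arrive V u x"
    | e i where "e \<in> E" "i \<in> set_pmf (D x e)" "y = transmit V (snd e) x i"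
    by (auto simp: targets_def)
  then show ?thesis
  proof cases
    case (2 e i)
    then show ?thesis
      using x good_transmit[OF x, of e] chosen_useful[of e _ x] by (cases i) auto
  qed (use x good_arrive in auto)
qed

lemma good_reachable:
  assumes "reachable q [] x"
  shows "good_state x"
  using assms unfolding reachable_def
proof (induction rule: rtranclp_induct)
  case base
  show ?case
    by (simp add: good_state_def)
qed (use good_step in blast)

definition backlog :: "'v \<times> 'v \<Rightarrow> 'v state \<Rightarrow> nat" where
  "backlog e x = cnt (pending e) x"

lemma backlog_arrive:
  assumes "e \<in> E" "u \<in> V"
  shows "backlog e (arrive V u x) = backlog e x + of_bool (u \<in> side E (fst e) (snd e))"
  using cnt_arrive[of "pending e" V u x, OF pending_not_full[OF assms(1)]]
    head_notin_side[of "fst e" "snd e"] assms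
  by (auto simp: backlog_def pending_def)

lemma backlog_transmit:
  assumes x: "good_state x" and e: "e \<in> E" and e': "e' \<in> E" and useful: "useful x e i"
  shows "backlog e' x = backlog e' (transmit V (snd e) x (Some i)) + of_bool (e' = e)"
proof -
  have "good (x ! i)" "fst e \<in> snd (x ! i)" "snd e \<notin> snd (x ! i)" "i < length x"
    using x useful by (auto simp: good_state_def useful_def)
  then show ?thesis
    using cnt_transmit[of "pending e'" V i x "snd e", OF pending_not_full[OF e']]
      pending_transmit[of "x ! i" e e'] e e'
    by (simp add: backlog_def del: transmit.simps)
qed

text \<open>Each packet present is missing at some node, hence pending on the link entering that
  node from the side of its source.\<close>

lemma length_le_backlog:
  assumes "good_state x"
  shows "length x \<le> (\<Sum>e\<in>E. backlog e x)"
proof -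
  have "cnt (\<lambda>_. True) x \<le> (\<Sum>e\<in>E. cnt (pending e) x)"
  proof (rule cnt_le_sum[OF finite_E])
    fix p assume "p \<in> set x"
    then have p: "good p"
      using assms by (simp add: good_state_def)
    then obtain b where "b \<in> V" "b \<notin> snd p"
      by (auto simp: good_def)
    moreover have "fst p \<in> V" "fst p \<noteq> b"
      using p calculation by (auto simp: good_def)
    ultimately obtain w where "(w, b) \<in> E" "fst p \<in> side E w b"
      using ex_incoming_side by blast
    with \<open>b \<notin> snd p\<close> show "\<exists>e\<in>E. pending e p"
      by (auto simp: pending_def intro!: bexI[of _ "(w, b)"])
  qed
  then show ?thesis
    by (simp add: backlog_def)
qed

lemma backlog_le_upstream:
  assumes x: "good_state x" and uv: "(u, v) \<in> E" and idle: "\<not> (\<exists>i. useful x (u, v) i)"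
  shows "backlog (u, v) x \<le> (\<Sum>f\<in>{f \<in> E. snd f = u \<and> fst f \<noteq> v}. backlog f x)"
  unfolding backlog_def
proof (rule cnt_le_sum)
  fix p assume p: "p \<in> set x" "pending (u, v) p"
  then have good: "good p"
    using x by (simp add: good_state_def)
  have "u \<notin> snd p"
    using p idle by (auto simp: in_set_conv_nth useful_def pending_def)
  \<comment> \<open>A good packet is available at its source, so a packet missing at
    \<open>u\<close> has its source elsewhere.\<close>
  moreover have "fst p \<noteq> u"
    using good calculation by (auto simp: good_def)
  ultimately obtain w where "(w, u) \<in> E" "w \<noteq> v" "fst p \<in> side E w u"
    using ex_incoming_side_other[OF uv, of "fst p"] p(2) by (auto simp: pending_def)
  with \<open>u \<notin> snd p\<close> show "\<exists>f\<in>{f \<in> E. snd f = u \<and> fst f \<noteq> v}. pending f p"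
    by (auto simp: pending_def intro!: bexI[of _ "(w, u)"])
qed (use finite_E in simp)

text \<open>A path from the source of a packet to a node missing it leaves the set of nodes holding
  it at some link.\<close>

lemma ex_useful:
  assumes "good_state x" "x \<noteq> []"
  shows "\<exists>e\<in>E. \<exists>i. useful x e i"
proof -
  have p: "good (x ! 0)"
    using assms by (auto simp: good_state_def)
  then obtain b where b: "b \<in> V" "b \<notin> snd (x ! 0)"
    by (auto simp: good_def)
  have "(fst (x ! 0), b) \<in> E\<^sup>*"
    using p b by (intro connected) (auto simp: good_def)
  then obtain a c where "(a, c) \<in> E" "a \<in> snd (x ! 0)" "c \<notin> snd (x ! 0)"
    using rtrancl_leaves_set[of "fst (x ! 0)" b E "snd (x ! 0)"] p b(2) unfolding good_def by blast
  then show ?thesis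
    using assms(2) by (intro bexI[of _ "(a, c)"] exI[of _ 0]) (auto simp: useful_def)
qed

end

section \<open>Irreducibility and exit rates under work conservation\<close>

locale work_conserving_network = network V E arr cap D
  for V :: "'v set" and E and arr :: "'v \<Rightarrow> real" and cap and D :: "'v discipline" +
  assumes work_conserving: "work_conserving E D"
begin

lemma choice_busy:
  assumes "e \<in> E" "\<exists>i. useful x e i" "i \<in> set_pmf (D x e)"
  shows "\<exists>j. i = Some j \<and> useful x e j"
  using assms work_conserving chosen_useful[of e _ x] unfolding work_conserving_def
  by (cases i) blast+

lemma choice_idle:
  assumes "e \<in> E" "\<not> (\<exists>i. useful x e i)" "i \<in> set_pmf (D x e)"
  shows "i = None"
  using assms chosen_useful[of e _ x] by (cases i) auto

lemma transmit_neq: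
  assumes "good_state x" "e \<in> E" "useful x e i"
  shows "transmit V (snd e) x (Some i) \<noteq> x"
  using backlog_transmit[OF assms(1,2,2,3)] by auto

lemma exit_rate_busy:
  assumes x: "good_state x" and e: "e \<in> E" and busy: "\<exists>i. useful x e i"
  shows "cap e \<le> exit_rate q x"
proof -
  let ?E = "\<lambda>e. measure_pmf.expectation (D x e) (\<lambda>i. of_bool (transmit V (snd e) x i \<noteq> x)) :: real"
  have nonneg: "0 \<le> ?E e" for e
    by (intro Bochner_Integration.integral_nonneg) auto
  have "1 \<le> ?E e"
    using choice_busy[OF e busy] transmit_neq[OF x e] finite_choice[OF e]
    by (intro pmf_expectation_ge_const) fastforce+
  then have "cap e \<le> cap e * ?E e"
    using cap_pos[OF e] by simp
  also have "\<dots> \<le> (\<Sum>e\<in>E. cap e * ?E e)"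
    using finite_E e cap_pos nonneg by (intro member_le_sum mult_nonneg_nonneg) (auto intro: less_imp_le)
  also have "\<dots> \<le> exit_rate q x"
    unfolding exit_rate_sum using arr_nonneg by (auto intro!: sum_nonneg)
  finally show ?thesis .
qed

text \<open>Serving any busy link strictly lowers the total backlog and has positive rate, so
  repeating this empties the network.\<close>

lemma reachable_empty:
  assumes "good_state x"
  shows "reachable q x []"
  using assms
proof (induction "\<Sum>e\<in>E. backlog e x" arbitrary: x rule: less_induct)
  case less
  show ?case
  proof (cases "x = []")
    case True
    then show ?thesis
      by (simp add: reachable_def)
  next
    case False
    then obtain e where e: "e \<in> E" "\<exists>i. useful x e i"
      using ex_useful less.prems by blast
    obtain i where i: "Some i \<in> set_pmf (D x e)" "useful x e i"
      using choice_busy[OF e] set_pmf_not_empty[of "D x e"] by blast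
    define y where "y = transmit V (snd e) x (Some i)"
    have good: "good_state y"
      unfolding y_def using good_transmit less.prems e(1) i(2) by blast
    have "0 < q x y"
    proof -
      have "0 < pmf (map_pmf (transmit V (snd e) x) (D x e)) y"
        using i(1) unfolding y_def by (intro pmf_positive) (simp only: set_map_pmf imageI)
      then have "0 < cap e * pmf (map_pmf (transmit V (snd e) x) (D x e)) y"
        using cap_pos[OF e(1)] by simp
      also have "\<dots> \<le> (\<Sum>e\<in>E. cap e * pmf (map_pmf (transmit V (snd e) x) (D x e)) y)"
        using finite_E e by (intro member_le_sum mult_nonneg_nonneg cap_nonneg pmf_nonneg) auto
      also have "\<dots> \<le> q x y"
        unfolding network_rate_def using arr_nonneg by (auto intro!: sum_nonneg)
      finally show ?thesis .
    qed
    moreover have "y \<noteq> x"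
      using transmit_neq[OF less.prems e(1) i(2)] by (simp add: y_def)
    moreover have "(\<Sum>e\<in>E. backlog e y) < (\<Sum>e\<in>E. backlog e x)"
      using finite_E e(1) backlog_transmit[OF less.prems e(1) _ i(2)]
      by (intro sum_strict_mono_ex1) (auto simp: y_def simp del: transmit.simps)
    then have "reachable q y []"
      using less.hyps good by blast
    ultimately show ?thesis
      unfolding reachable_def by (auto intro: converse_rtranclp_into_rtranclp)
  qed
qed

lemma exit_rate_lower_bound:
  obtains c where "0 < c" "\<And>x. reachable q [] x \<Longrightarrow> exit_rate q [] \<noteq> 0 \<Longrightarrow> c \<le> exit_rate q x"
proof
  \<comment> \<open>The value 1 keeps the minimum positive when the empty state is absorbing. Every
    other good state has a busy link and therefore exit rate at least its capacity.\<close>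
  let ?A = "insert (if exit_rate q [] = 0 then 1 else exit_rate q []) (cap ` E)"
  show "0 < Min ?A"
    using finite_E cap_pos exit_rate_nonneg[of "[]"] by (subst Min_gr_iff) (auto simp: less_le)
  fix x assume x: "reachable q [] x" "exit_rate q [] \<noteq> 0"
  have good: "good_state x"
    using x(1) by (rule good_reachable)
  show "Min ?A \<le> exit_rate q x"
  proof (cases "x = []")
    case True
    then show ?thesis
      using finite_E x(2) by (auto intro!: Min_le)
  next
    case False
    then obtain e where e: "e \<in> E" "\<exists>i. useful x e i"
      using ex_useful good by blast
    have "Min ?A \<le> cap e"
      using finite_E e(1) by (intro Min_le) auto
    also have "\<dots> \<le> exit_rate q x"
      by (rule exit_rate_busy[OF good e])
    finally show ?thesis .
  qed
qed

section \<open>The quadratic Lyapunov function\<close>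

lemma ex_weights:
  assumes \<delta>: "\<And>e. e \<in> E \<Longrightarrow> 0 < \<delta> e"
  obtains \<alpha> :: "'v \<times> 'v \<Rightarrow> real" where "\<And>e. 0 \<le> \<alpha> e"
    and "\<And>f. f \<in> E \<Longrightarrow> 1 + (\<Sum>e\<in>{e \<in> E. fst e = snd f \<and> snd e \<noteq> fst f}. \<alpha> e * cap e) \<le> \<alpha> f * \<delta> f"
proof -
  define K where "K = Max (insert 1 ((\<lambda>f. (1 + sum cap E) / \<delta> f) ` E))"
  \<comment> \<open>Sides grow strictly downstream, so \<open>h\<close> falls strictly; the weights
    \<open>K ^ h e\<close> gain at least a factor \<open>K\<close> per link upstream.\<close>
  define h where "h e = card V - card (side E (fst e) (snd e))" for e
  have K: "1 \<le> K" "(1 + sum cap E) / \<delta> f \<le> K" if "f \<in> E" for f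
    unfolding K_def using finite_E that by (auto intro!: Max_ge)
  have K1: "1 \<le> K"
    unfolding K_def using finite_E by (auto intro!: Max_ge)
  have succ: "h e < h f" if f: "f \<in> E" and e: "e \<in> E" "fst e = snd f" "snd e \<noteq> fst f" for e f
  proof -
    have "side E (fst f) (snd f) \<subset> side E (fst e) (snd e)"
      using side_mono[of "fst f" "snd f" "snd e"] e f by (metis prod.collapse)
    moreover have "side E (fst e) (snd e) \<subset> V"
      using side_psubset[of "fst e" "snd e"] e(1) by simp
    ultimately have "card (side E (fst f) (snd f)) < card (side E (fst e) (snd e))"
        "card (side E (fst e) (snd e)) < card V"
      using finite_V by (auto intro!: psubset_card_mono intro: finite_subset)
    then show ?thesis
      unfolding h_def by simp
  qed
  have pos: "0 < h f" if "f \<in> E" for f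
    unfolding h_def using side_psubset[of "fst f" "snd f"] that finite_V by (simp add: psubset_card_mono)
  have "1 + (\<Sum>e\<in>{e \<in> E. fst e = snd f \<and> snd e \<noteq> fst f}. K ^ h e * cap e) \<le> K ^ h f * \<delta> f" if f: "f \<in> E" for f
  proof -
    have "(\<Sum>e\<in>{e \<in> E. fst e = snd f \<and> snd e \<noteq> fst f}. K ^ h e * cap e)
        \<le> (\<Sum>e\<in>{e \<in> E. fst e = snd f \<and> snd e \<noteq> fst f}. K ^ (h f - 1) * cap e)"
      using succ[OF f] K1 cap_pos
      by (intro sum_mono mult_right_mono power_increasing) (force intro: less_imp_le)+
    also have "\<dots> \<le> (\<Sum>e\<in>E. K ^ (h f - 1) * cap e)"
      using finite_E K1 cap_pos by (intro sum_mono2) (auto intro: less_imp_le)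
    finally have "1 + (\<Sum>e\<in>{e \<in> E. fst e = snd f \<and> snd e \<noteq> fst f}. K ^ h e * cap e)
        \<le> K ^ (h f - 1) + K ^ (h f - 1) * sum cap E"
      using one_le_power[OF K1, of "h f - 1"] by (simp add: sum_distrib_left)
    also have "\<dots> = K ^ (h f - 1) * (1 + sum cap E)"
      by (simp add: distrib_left)
    \<comment> \<open>Here \<open>K\<close> dominates \<open>(1 + sum cap E) / \<delta> f\<close>.
      The exponent \<open>h f - 1\<close> is a true predecessor because \<open>h f\<close> is
      positive.\<close>
    also have "\<dots> \<le> K ^ (h f - 1) * (K * \<delta> f)"
      using K(2)[OF f] \<delta>[OF f] K1 by (intro mult_left_mono) (auto simp: field_simps)
    also have "\<dots> = K ^ h f * \<delta> f"
      using pos[OF f] by (cases "h f") auto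
    finally show ?thesis .
  qed
  then show thesis
    using K1 by (intro that[of "\<lambda>e. K ^ h e"]) auto
qed

definition load :: "'v \<times> 'v \<Rightarrow> real" where
  "load e = sum arr (side E (fst e) (snd e))"

abbreviation busy :: "'v state \<Rightarrow> 'v \<times> 'v \<Rightarrow> bool" where
  "busy x e \<equiv> \<exists>i. useful x e i"

text \<open>A unit increase changes a square \<open>W^2\<close> by \<open>2 * W + 1\<close>, a unit
  decrease by \<open>1 - 2 * W\<close>. The linear parts form the second sum, the unit parts are
  bounded by the first.\<close>

lemma drift_quadratic_le:
  fixes \<alpha> :: "'v \<times> 'v \<Rightarrow> real"
  assumes x: "good_state x" and \<alpha>: "\<And>e. 0 \<le> \<alpha> e"
  shows "drift q (\<lambda>x. \<Sum>e\<in>E. \<alpha> e * (real (backlog e x))\<^sup>2) x \<le> (\<Sum>e\<in>E. \<alpha> e * (load e + cap e))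
    + 2 * (\<Sum>e\<in>E. \<alpha> e * (real (backlog e x) * (load e - cap e * of_bool (busy x e))))"
proof -
  define L where "L = (\<lambda>x. \<Sum>e\<in>E. \<alpha> e * (real (backlog e x))\<^sup>2)"
  let ?W = "\<lambda>e. real (backlog e x)"
  let ?S = "\<lambda>e. side E (fst e) (snd e)"
  have "(\<Sum>u\<in>V. arr u * (L (arrive V u x) - L x)) = (\<Sum>u\<in>V. \<Sum>e\<in>E. \<alpha> e * (2 * ?W e + 1) * (if u \<in> ?S e then arr u else 0))"
  proof (rule sum.cong[OF refl])
    fix u assume u: "u \<in> V"
    have "L (arrive V u x) - L x = (\<Sum>e\<in>E. \<alpha> e * (2 * ?W e + 1) * (if u \<in> ?S e then 1 else 0))"
      unfolding L_def sum_subtractf[symmetric] using u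
      by (intro sum.cong) (auto simp: backlog_arrive power2_eq_square algebra_simps)
    then show "arr u * (L (arrive V u x) - L x) = (\<Sum>e\<in>E. \<alpha> e * (2 * ?W e + 1) * (if u \<in> ?S e then arr u else 0))"
      by (simp add: sum_distrib_left) (auto intro!: sum.cong)
  qed
  also have "\<dots> = (\<Sum>e\<in>E. \<Sum>u\<in>V. \<alpha> e * (2 * ?W e + 1) * (if u \<in> ?S e then arr u else 0))"
    by (rule sum.swap)
  also have "\<dots> = (\<Sum>e\<in>E. \<alpha> e * (2 * ?W e + 1) * load e)"
  proof (rule sum.cong[OF refl])
    fix e assume "e \<in> E"
    then have "?S e \<subseteq> V"
      using side_subset[of "fst e" "snd e"] by simp
    then have "(\<Sum>u\<in>V. if u \<in> ?S e then arr u else 0) = load e"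
      unfolding load_def using finite_V by (subst sum.inter_restrict[symmetric]) (auto simp: Int_absorb1)
    then show "(\<Sum>u\<in>V. \<alpha> e * (2 * ?W e + 1) * (if u \<in> ?S e then arr u else 0)) = \<alpha> e * (2 * ?W e + 1) * load e"
      by (simp only: sum_distrib_left[symmetric])
  qed
  finally have arrivals: "(\<Sum>u\<in>V. arr u * (L (arrive V u x) - L x)) = (\<Sum>e\<in>E. \<alpha> e * (2 * ?W e + 1) * load e)" .
  have "L (transmit V (snd e) x i) - L x \<le> of_bool (busy x e) * (\<alpha> e * (1 - 2 * ?W e))"
    if e: "e \<in> E" and i: "i \<in> set_pmf (D x e)" for e i
  proof (cases "busy x e")
    case False
    then show ?thesis
      using choice_idle[OF e _ i] by simp
  next
    case True
    then obtain j where j: "i = Some j" "useful x e j"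
      using choice_busy[OF e _ i] by blast
    have "L (transmit V (snd e) x i) - L x = (\<Sum>e'\<in>E. if e' = e then \<alpha> e * (1 - 2 * ?W e) else 0)"
      unfolding L_def sum_subtractf[symmetric] j(1)
    proof (rule sum.cong[OF refl])
      fix e' assume "e' \<in> E"
      from backlog_transmit[OF x e this j(2)]
      have "?W e' = real (backlog e' (transmit V (snd e) x (Some j))) + of_bool (e' = e)"
        by (simp only: of_nat_add of_nat_of_bool)
      then have W: "real (backlog e' (transmit V (snd e) x (Some j))) = ?W e' - of_bool (e' = e)"
        by simp
      show "\<alpha> e' * (real (backlog e' (transmit V (snd e) x (Some j))))\<^sup>2 - \<alpha> e' * (?W e')\<^sup>2
          = (if e' = e then \<alpha> e * (1 - 2 * ?W e) else 0)"
        unfolding W by (simp add: power2_eq_square algebra_simps)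
    qed
    also have "\<dots> = \<alpha> e * (1 - 2 * ?W e)"
      using finite_E e by simp
    finally show ?thesis
      using True by simp
  qed
  then have "cap e * measure_pmf.expectation (D x e) (\<lambda>i. L (transmit V (snd e) x i) - L x)
      \<le> cap e * (of_bool (busy x e) * (\<alpha> e * (1 - 2 * ?W e)))" if "e \<in> E" for e
    using that finite_choice by (intro mult_left_mono pmf_expectation_le_const cap_nonneg) auto
  \<comment> \<open>For an idle link the left side vanishes and \<open>\<alpha> e * cap e\<close> is
    slack.\<close>
  moreover have "cap e * (of_bool (busy x e) * (\<alpha> e * (1 - 2 * ?W e)))
      \<le> \<alpha> e * cap e - 2 * (\<alpha> e * (?W e * (cap e * of_bool (busy x e))))" if "e \<in> E" for e
    using that cap_pos[OF that] \<alpha>[of e] by (cases "busy x e") (simp_all add: algebra_simps)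
  ultimately have transmissions: "(\<Sum>e\<in>E. cap e * measure_pmf.expectation (D x e) (\<lambda>i. L (transmit V (snd e) x i) - L x))
      \<le> (\<Sum>e\<in>E. \<alpha> e * cap e - 2 * (\<alpha> e * (?W e * (cap e * of_bool (busy x e)))))"
    by (intro sum_mono) (blast intro: order_trans)
  have "drift q L x \<le> (\<Sum>e\<in>E. \<alpha> e * (2 * ?W e + 1) * load e)
      + (\<Sum>e\<in>E. \<alpha> e * cap e - 2 * (\<alpha> e * (?W e * (cap e * of_bool (busy x e)))))"
    unfolding drift_eq arrivals using transmissions by simp
  also have "\<dots> = (\<Sum>e\<in>E. \<alpha> e * (load e + cap e))
    + 2 * (\<Sum>e\<in>E. \<alpha> e * (?W e * (load e - cap e * of_bool (busy x e))))"
    unfolding sum.distrib[symmetric] sum_distrib_left by (intro sum.cong) (simp_all add: algebra_simps)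
  finally show ?thesis
    by (simp add: L_def)
qed

text \<open>An idle link with a backlog owes it to its upstream links, whose weights are larger.\<close>

lemma weighted_backlog_decreases:
  fixes \<alpha> :: "'v \<times> 'v \<Rightarrow> real"
  assumes x: "good_state x" and \<alpha>: "\<And>e. 0 \<le> \<alpha> e"
    and weights: "\<And>f. f \<in> E \<Longrightarrow>
      1 + (\<Sum>e\<in>{e \<in> E. fst e = snd f \<and> snd e \<noteq> fst f}. \<alpha> e * cap e) \<le> \<alpha> f * (cap f - load f)"
  shows "(\<Sum>e\<in>E. \<alpha> e * (real (backlog e x) * (load e - cap e * of_bool (busy x e))))
    \<le> - (\<Sum>e\<in>E. real (backlog e x))"
proof -
  let ?W = "\<lambda>e. real (backlog e x)"
  let ?up = "\<lambda>e. {f \<in> E. snd f = fst e \<and> fst f \<noteq> snd e}"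
  let ?down = "\<lambda>f. {e \<in> E. snd f = fst e \<and> fst f \<noteq> snd e}"
  have "\<alpha> e * (?W e * (load e - cap e * of_bool (busy x e)))
      \<le> (\<Sum>f\<in>?up e. \<alpha> e * cap e * ?W f) - ?W e * (\<alpha> e * (cap e - load e))" if e: "e \<in> E" for e
  proof -
    \<comment> \<open>For a busy link the upstream sum is slack; for an idle one it replaces the
      missing service.\<close>
    have "?W e * (load e - cap e * of_bool (busy x e)) \<le> cap e * (\<Sum>f\<in>?up e. ?W f) - ?W e * (cap e - load e)"
    proof (cases "busy x e")
      case True
      have "0 \<le> cap e * (\<Sum>f\<in>?up e. ?W f)"
        using cap_pos[OF e] by (intro mult_nonneg_nonneg sum_nonneg) auto
      with True show ?thesis
        by (simp add: algebra_simps)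
    next
      case False
      then have "backlog e x \<le> (\<Sum>f\<in>?up e. backlog f x)"
        using backlog_le_upstream[OF x, of "fst e" "snd e"] e by simp
      then have "?W e \<le> (\<Sum>f\<in>?up e. ?W f)"
        by (simp only: of_nat_le_iff of_nat_sum[symmetric])
      then have "cap e * ?W e \<le> cap e * (\<Sum>f\<in>?up e. ?W f)"
        using cap_pos[OF e] by simp
      with False show ?thesis
        by (simp add: algebra_simps)
    qed
    from mult_left_mono[OF this \<alpha>[of e]] show ?thesis
      by (simp add: algebra_simps sum_distrib_left)
  qed
  then have "(\<Sum>e\<in>E. \<alpha> e * (?W e * (load e - cap e * of_bool (busy x e))))
      \<le> (\<Sum>e\<in>E. (\<Sum>f\<in>?up e. \<alpha> e * cap e * ?W f) - ?W e * (\<alpha> e * (cap e - load e)))"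
    by (rule sum_mono)
  also have "\<dots> = (\<Sum>e\<in>E. \<Sum>f\<in>?up e. \<alpha> e * cap e * ?W f) - (\<Sum>f\<in>E. ?W f * (\<alpha> f * (cap f - load f)))"
    by (rule sum_subtractf)
  \<comment> \<open>Exchanging the sums collects at each \<open>f\<close> the weights of the links
    directly downstream, which \<open>weights\<close> bounds.\<close>
  also have "(\<Sum>e\<in>E. \<Sum>f\<in>?up e. \<alpha> e * cap e * ?W f) = (\<Sum>f\<in>E. \<Sum>e\<in>?down f. \<alpha> e * cap e * ?W f)"
    by (rule sum.swap_restrict[OF finite_E finite_E])
  also have "\<dots> = (\<Sum>f\<in>E. ?W f * (\<Sum>e\<in>{e \<in> E. fst e = snd f \<and> snd e \<noteq> fst f}. \<alpha> e * cap e))"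
    by (intro sum.cong) (auto simp: sum_distrib_left mult.commute intro!: sum.cong)
  also have "\<dots> - (\<Sum>f\<in>E. ?W f * (\<alpha> f * (cap f - load f))) =
      (\<Sum>f\<in>E. ?W f * ((\<Sum>e\<in>{e \<in> E. fst e = snd f \<and> snd e \<noteq> fst f}. \<alpha> e * cap e) - \<alpha> f * (cap f - load f)))"
    by (simp add: sum_subtractf right_diff_distrib)
  also have "\<dots> \<le> (\<Sum>f\<in>E. ?W f * (- 1))"
    using weights by (intro sum_mono mult_left_mono) (force simp: algebra_simps)+
  finally show ?thesis
    by (simp add: sum_negf)
qed

lemma stable:
  assumes load: "\<And>e. e \<in> E \<Longrightarrow> load e < cap e"
  shows "network_stable V E arr cap D"
proof -
  have pos: "0 < cap e - load e" if "e \<in> E" for e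
    using load[OF that] by simp
  obtain \<alpha> :: "'v \<times> 'v \<Rightarrow> real" where \<alpha>: "\<And>e. 0 \<le> \<alpha> e"
    and weights: "\<And>f. f \<in> E \<Longrightarrow>
      1 + (\<Sum>e\<in>{e \<in> E. fst e = snd f \<and> snd e \<noteq> fst f}. \<alpha> e * cap e) \<le> \<alpha> f * (cap f - load f)"
    using ex_weights[of "\<lambda>e. cap e - load e", OF pos] by blast
  define C where "C = (\<Sum>e\<in>E. \<alpha> e * (load e + cap e))"
  define L where "L = (\<lambda>x. \<Sum>e\<in>E. \<alpha> e * (real (backlog e x))\<^sup>2)"
  \<comment> \<open>Beyond length \<open>n\<close> the bound \<open>C - 2 * length x\<close> is at
    most \<open>- total_rate\<close>; \<open>F\<close> contains all good states that are not
    longer.\<close>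
  obtain n :: nat where n: "(C + total_rate) / 2 \<le> real n"
    using real_arch_simple by blast
  define F where "F = {x. set x \<subseteq> V \<times> Pow V \<and> length x \<le> n}"
  have drift: "drift q L x \<le> C - 2 * real (length x)" if "good_state x" for x
  proof -
    have "drift q L x \<le> C + 2 * - (\<Sum>e\<in>E. real (backlog e x))"
      using drift_quadratic_le[where \<alpha>=\<alpha>, OF that \<alpha>]
        weighted_backlog_decreases[where \<alpha>=\<alpha>, OF that \<alpha> weights]
      unfolding C_def L_def by linarith
    moreover have "real (length x) \<le> (\<Sum>e\<in>E. real (backlog e x))"
      using length_le_backlog[OF that] by (simp only: of_nat_le_iff of_nat_sum[symmetric])
    ultimately show ?thesis
      by simp
  qed
  obtain c where c: "0 < c" "\<And>x. reachable q [] x \<Longrightarrow> exit_rate q [] \<noteq> 0 \<Longrightarrow> c \<le> exit_rate q x"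
    using exit_rate_lower_bound by blast
  show ?thesis
    unfolding network_stable_def
  proof (rule foster_positive_recurrent[where F=F and L=L and c=c])
    show "finite F"
      unfolding F_def using finite_V by (intro finite_lists_length_le) auto
    show "0 \<le> L x" for x
      unfolding L_def using \<alpha> by (intro sum_nonneg) auto
    fix x assume x: "reachable q [] x"
    then have good: "good_state x"
      by (rule good_reachable)
    then show "reachable q x []"
      by (rule reachable_empty)
    show "drift q L x \<le> - total_rate" if "x \<notin> F"
    proof -
      have "set x \<subseteq> V \<times> Pow V"
        using good by (fastforce simp: good_state_def good_def)
      then have "n < length x"
        using that by (auto simp: F_def)
      then show ?thesis
        using drift[OF good] n by (simp add: field_simps)
    qed
  qed (use c in auto)
qed

end

theorem theorem5p1:
  fixes V :: "'v set" and E :: "('v \<times> 'v) set"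
    and arr :: "'v \<Rightarrow> real" and cap :: "'v \<times> 'v \<Rightarrow> real"
    and D :: "'v discipline"
  assumes "finite V"
    and "tree_structure V E"
    and "\<And>u. u \<in> V \<Longrightarrow> 0 \<le> arr u"
    and "\<And>u v. (u, v) \<in> E \<Longrightarrow> 0 < cap (u, v)"
    and "is_discipline E D"
    and "work_conserving E D"
  shows "network_stable V E arr cap D \<longleftrightarrow>
    (\<forall>S. S \<subset> V \<and> 0 < (\<Sum>u\<in>S. arr u) \<longrightarrow>
      (\<Sum>u\<in>S. arr u) < (\<Sum>(u, v) \<in> {(u, v) \<in> E. u \<in> S \<and> v \<notin> S}. cap (u, v)))"
proof -
  interpret work_conserving_network V E arr cap D
    using assms by unfold_locales auto
  show ?thesis
  proof (intro iffI allI impI)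
    fix S assume "network_stable V E arr cap D" and S: "S \<subset> V \<and> 0 < sum arr S"
    then show "sum arr S < (\<Sum>(u, v) \<in> {(u, v) \<in> E. u \<in> S \<and> v \<notin> S}. cap (u, v))"
      using not_stable[of S] by force
  next
    assume cut: "\<forall>S. S \<subset> V \<and> 0 < sum arr S \<longrightarrow>
      sum arr S < (\<Sum>(u, v) \<in> {(u, v) \<in> E. u \<in> S \<and> v \<notin> S}. cap (u, v))"
    show "network_stable V E arr cap D"
    proof (rule stable)
      fix e assume e: "e \<in> E"
      \<comment> \<open>The cut around this side consists of \<open>e\<close> alone, and positivity
        of \<open>cap e\<close> settles the case of zero load.\<close>
      let ?S = "side E (fst e) (snd e)"
      have "?S \<subset> V" "(\<Sum>(u, v) \<in> {(u, v) \<in> E. u \<in> ?S \<and> v \<notin> ?S}. cap (u, v)) = cap e"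
        using side_psubset[of "fst e" "snd e"] cut_side[of "fst e" "snd e"] e by simp_all
      moreover have "0 < cap e"
        using e by (rule cap_pos)
      ultimately show "load e < cap e"
        using cut[rule_format, of ?S] unfolding load_def by force
    qed
  qed
qed

end
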